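(* For any domain $\Omega\subset\mathbb{R}^n$ $(n\ge 3)$ we have $\rho_\Omega=\tau_\Omega$ on $\Omega\times\Omega$, where $\rho_\Omega$ is the minimal pseudodistance obtained by integrating the minimal pseudometric $g_\Omega$, and $\tau_\Omega$ is the pseudodistance defined by chains of conformal harmonic discs in $\Omega$.
   Context: A domain is a nonempty connected open set. $\mathbb{D}=\{z=x+iy\in\mathbb{C}:|z|<1\}$. A $C^1$ map $f$ from an open subset of $\mathbb{R}^2=\mathbb{C}$ to $\mathbb{R}^n$ is conformal if $|f_x|=|f_y|$ and $f_x\cdot f_y=0$ at every point (it need not be an immersion). $\mathrm{CH}(\mathbb{D},\Omega)$ denotes the set of all conformal harmonic maps $\mathbb{D}\to\Omega$. Minimal pseudometric: for $\mathbf{x}\in\Omega$, $\mathbf{v}\in\mathbb{R}^n$, $$g_\Omega(\mathbf{x},\mathbf{v})=\inf\{1/r>0:\exists f\in \mathrm{CH}(\mathbb{D},\Omega),\ f(0)=\mathbf{x},\ f_x(0)=r\mathbf{v}\}.$$ Minimal pseudodistance: $\rho_\Omega(\mathbf{x},\mathbf{y})=\inf_\gamma\int_0^1 g_\Omega(\gamma(t),\dot\gamma(t))\,dt$, the infimum over all piecewise smooth paths $\gamma:[0,1]\to\Omega$ with $\gamma(0)=\mathbf{x}$, $\gamma(1)=\mathbf{y}$. Chain pseudodistance: for $\mathbf{x},\mathbf{y}\in\Omega$ consider finite chains of maps $f_i\in\mathrm{CH}(\mathbb{D},\Omega)$ and points $a_i\in\mathbb{D}$ $(i=1,\dots,k)$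 such that $f_1(0)=\mathbf{x}$, $f_{i+1}(0)=f_i(a_i)$ for $i=1,\dots,k-1$, and $f_k(a_k)=\mathbf{y}$. The length of the chain is $\sum_{i=1}^k\frac12\log\frac{1+|a_i|}{1-|a_i|}$, and $\tau_\Omega(\mathbf{x},\mathbf{y})$ is the infimum of the lengths of all such chains. *)

theory Defs
  imports "HOL-Analysis.Analysis"
begin

definition partial_x :: "(complex \<Rightarrow> 'a::real_normed_vector) \<Rightarrow> complex \<Rightarrow> 'a"
  where "partial_x f z = frechet_derivative f (at z) 1"

definition partial_y :: "(complex \<Rightarrow> 'a::real_normed_vector) \<Rightarrow> complex \<Rightarrow> 'a"
  where "partial_y f z = frechet_derivative f (at z) \<i>"

(* Differentiability here is over the reals. The predicates below are meant for open U. *)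
definition C1_on :: "complex set \<Rightarrow> (complex \<Rightarrow> 'a::real_normed_vector) \<Rightarrow> bool"
  where "C1_on U f \<longleftrightarrow> (\<forall>z\<in>U. f differentiable (at z)) \<and>
    continuous_on U (partial_x f) \<and> continuous_on U (partial_y f)"

definition C2_on :: "complex set \<Rightarrow> (complex \<Rightarrow> 'a::real_normed_vector) \<Rightarrow> bool"
  where "C2_on U f \<longleftrightarrow> C1_on U f \<and> C1_on U (partial_x f) \<and> C1_on U (partial_y f)"

definition harmonic_map_on :: "complex set \<Rightarrow> (complex \<Rightarrow> 'a::real_normed_vector) \<Rightarrow> bool"
  where "harmonic_map_on U f \<longleftrightarrow> C2_on U f \<and>
    (\<forall>z\<in>U. partial_x (partial_x f) z + partial_y (partial_y f) z = 0)"

definition conformal_map_on :: "complex set \<Rightarrow> (complex \<Rightarrow> 'a::real_inner) \<Rightarrow> bool"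
  where "conformal_map_on U f \<longleftrightarrow> C1_on U f \<and>
    (\<forall>z\<in>U. norm (partial_x f z) = norm (partial_y f z) \<and> partial_x f z \<bullet> partial_y f z = 0)"

abbreviation unit_disc :: "complex set" where "unit_disc \<equiv> ball 0 1"

(* Maps on the disc are represented by total functions; values off the disc are irrelevant. *)
definition CH :: "'a::real_inner set \<Rightarrow> (complex \<Rightarrow> 'a) set"
  where "CH \<Omega> = {f. f ` unit_disc \<subseteq> \<Omega> \<and> harmonic_map_on unit_disc f \<and> conformal_map_on unit_disc f}"

(* Infima are taken in [0,\<infinity>], where the infimum of the empty set is \<infinity>
   (the real-valued Inf is unspecified there) and every integral of a nonnegative function
   has its proper value (the real-valued integral of a non-integrable function is 0). *)
definition minimal_metric :: "'a::real_inner set \<Rightarrow> 'a \<Rightarrow> 'a \<Rightarrow> ennreal"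
  where "minimal_metric \<Omega> x v =
    Inf {ennreal (1 / r) | r. 1 / r > 0 \<and> (\<exists>f \<in> CH \<Omega>. f 0 = x \<and> partial_x f 0 = r *\<^sub>R v)}"

(* C^\<infinity> on the closed interval, with one-sided derivatives of all orders at the endpoints:
   D k is the k-th derivative. *)
definition smooth_on_interval :: "real \<Rightarrow> real \<Rightarrow> (real \<Rightarrow> 'a::real_normed_vector) \<Rightarrow> bool"
  where "smooth_on_interval a b \<gamma> \<longleftrightarrow> (\<exists>D :: nat \<Rightarrow> real \<Rightarrow> 'a.
    (\<forall>t\<in>{a..b}. D 0 t = \<gamma> t) \<and>
    (\<forall>k. \<forall>t\<in>{a..b}. (D k has_vector_derivative D (Suc k) t) (at t within {a..b})))"

(* Unlike valid_path, this bounds the derivative near the break points. *)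
definition piecewise_smooth_path :: "(real \<Rightarrow> 'a::real_normed_vector) \<Rightarrow> bool"
  where "piecewise_smooth_path \<gamma> \<longleftrightarrow> path \<gamma> \<and> (\<exists>(N::nat) (s :: nat \<Rightarrow> real). s 0 = 0 \<and> s N = 1 \<and>
    (\<forall>i<N. s i < s (Suc i) \<and> smooth_on_interval (s i) (s (Suc i)) \<gamma>))"

definition piecewise_smooth_paths_in :: "'a::real_normed_vector set \<Rightarrow> 'a \<Rightarrow> 'a \<Rightarrow> (real \<Rightarrow> 'a) set"
  where "piecewise_smooth_paths_in \<Omega> x y = {\<gamma>. piecewise_smooth_path \<gamma> \<and>
    path_image \<gamma> \<subseteq> \<Omega> \<and> pathstart \<gamma> = x \<and> pathfinish \<gamma> = y}"

(* vector_derivative is unspecified at break points, which form a null set. *)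
definition minimal_distance :: "'a::real_inner set \<Rightarrow> 'a \<Rightarrow> 'a \<Rightarrow> ennreal"
  where "minimal_distance \<Omega> x y = (INF \<gamma> \<in> piecewise_smooth_paths_in \<Omega> x y.
    \<integral>\<^sup>+t\<in>{0..1}. minimal_metric \<Omega> (\<gamma> t) (vector_derivative \<gamma> (at t)) \<partial>lborel)"

definition disc_chain ::
    "'a::real_inner set \<Rightarrow> 'a \<Rightarrow> 'a \<Rightarrow> nat \<Rightarrow> (nat \<Rightarrow> complex \<Rightarrow> 'a) \<Rightarrow> (nat \<Rightarrow> complex) \<Rightarrow> bool"
  where "disc_chain \<Omega> x y k f a \<longleftrightarrow> k \<ge> 1 \<and>
    (\<forall>i\<in>{1..k}. f i \<in> CH \<Omega> \<and> a i \<in> unit_disc) \<and>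
    f 1 0 = x \<and> (\<forall>i\<in>{1..<k}. f (i + 1) 0 = f i (a i)) \<and> f k (a k) = y"

definition chain_length :: "nat \<Rightarrow> (nat \<Rightarrow> complex) \<Rightarrow> real"
  where "chain_length k a = (\<Sum>i=1..k. 1 / 2 * ln ((1 + norm (a i)) / (1 - norm (a i))))"

definition chain_distance :: "'a::real_inner set \<Rightarrow> 'a \<Rightarrow> 'a \<Rightarrow> ennreal"
  where "chain_distance \<Omega> x y = Inf {ennreal (chain_length k a) | k f a. disc_chain \<Omega> x y k f a}"

end

theory Submission
  imports Defs "HOL-Complex_Analysis.Complex_Analysis"
begin

text \<open>
  \<open>\<rho> \<le> \<tau>\<close>: the components of a conformal harmonic disc are real parts of holomorphic functions, so
  precomposition with holomorphic self-maps of the disc preserves the class. Precomposing with a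
  Moebius map bounds the minimal metric along a disc by the Poincare metric, whose integral over
  the radius from \<open>0\<close> to \<open>a\<close> is \<open>1/2 log ((1 + |a|) / (1 - |a|))\<close>.

  \<open>\<tau> \<le> \<rho>\<close>: along a path \<open>\<gamma>\<close> starting at \<open>x\<close> let \<open>u t = \<tau> x (\<gamma> t)\<close>. Affine discs show that \<open>u\<close> is
  locally Lipschitz. A disc \<open>f\<close> with \<open>f\<^sub>x 0 = r \<gamma>' t\<close> reaches \<open>\<gamma> (t + h)\<close> up to an error \<open>o(h)\<close>, which one
  more affine disc removes; hence the upper derivative of \<open>u\<close> at \<open>t\<close> is at most the minimal metric of
  \<open>\<gamma>' t\<close>. The reverse Fatou lemma integrates this inequality, so that neither semicontinuity nor
  measurability of the minimal metric is needed.
\<close>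

subsection \<open>Conformal harmonic discs and holomorphic functions\<close>

lemma has_derivative_vec_lambda:
  fixes f :: "'n::finite \<Rightarrow> 'a::euclidean_space \<Rightarrow> real"
  assumes "\<And>i. (f i has_derivative f' i) (at x)"
  shows "((\<lambda>x. \<chi> i. f i x) has_derivative (\<lambda>h. \<chi> i. f' i h)) (at x)"
proof (subst has_derivative_componentwise_within, intro ballI)
  fix b :: "real^'n" assume "b \<in> Basis"
  then obtain i where "b = axis i 1" by (auto simp: Basis_vec_def)
  then show "((\<lambda>x. (\<chi> i. f i x) \<bullet> b) has_derivative (\<lambda>h. (\<chi> i. f' i h) \<bullet> b)) (at x)"
    using assms[of i] by (simp add: inner_axis)
qed

lemma has_derivative_vec_nth:
  "(f has_derivative f') F \<Longrightarrow> ((\<lambda>x. f x $ i) has_derivative (\<lambda>h. f' h $ i)) F"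
  by (rule bounded_linear.has_derivative[OF bounded_linear_vec_nth])

lemma partial_derivatives:
  assumes "(f has_derivative D) (at z)"
  shows "partial_x f z = D 1" "partial_y f z = D \<i>" "f differentiable (at z)"
  using assms frechet_derivative_at[OF assms]
  by (auto simp: partial_x_def partial_y_def differentiable_def)

lemma C1_on_has_derivative:
  assumes "C1_on U f" "z \<in> U"
  shows "(f has_derivative (\<lambda>h. Re h *\<^sub>R partial_x f z + Im h *\<^sub>R partial_y f z)) (at z)"
proof -
  have D: "(f has_derivative frechet_derivative f (at z)) (at z)"
    using assms frechet_derivative_works by (auto simp: C1_on_def)
  then have lin: "linear (frechet_derivative f (at z))"
    by (rule has_derivative_linear)
  have "frechet_derivative f (at z) h = Re h *\<^sub>R partial_x f z + Im h *\<^sub>R partial_y f z" for h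
  proof -
    have "h = Re h *\<^sub>R 1 + Im h *\<^sub>R \<i>" by (simp add: complex_eq_iff)
    then have "frechet_derivative f (at z) h = frechet_derivative f (at z) (Re h *\<^sub>R 1 + Im h *\<^sub>R \<i>)"
      by simp
    then show ?thesis
      by (simp add: linear_add[OF lin] linear_scale[OF lin] partial_x_def partial_y_def)
  qed
  then show ?thesis using D by (metis (no_types, lifting) ext)
qed

text \<open>Schwarz's theorem by contradiction: the second difference of \<open>f\<close> over a
  small square equals the squared side times a value of \<open>b\<close> and also times a value of
  \<open>c\<close>. If \<open>b z\<close> and \<open>c z\<close> differed, continuity at
  \<open>z\<close> would keep such values apart on a sufficiently small square.\<close>

lemma mixed_partials_eq:
  fixes f p q a b c d :: "complex \<Rightarrow> real"
  assumes U: "open U" "z \<in> U"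
    and f: "\<And>z. z \<in> U \<Longrightarrow> (f has_derivative (\<lambda>h. Re h * p z + Im h * q z)) (at z)"
    and p: "\<And>z. z \<in> U \<Longrightarrow> (p has_derivative (\<lambda>h. Re h * a z + Im h * b z)) (at z)"
    and q: "\<And>z. z \<in> U \<Longrightarrow> (q has_derivative (\<lambda>h. Re h * c z + Im h * d z)) (at z)"
    and b: "continuous_on U b" and c: "continuous_on U c"
  shows "b z = c z"
proof (rule ccontr)
  assume ne: "b z \<noteq> c z"
  define e where "e = \<bar>b z - c z\<bar> / 2"
  have e: "e > 0" using ne by (simp add: e_def)
  obtain r0 where r0: "r0 > 0" "ball z r0 \<subseteq> U" using U open_contains_ball by blast
  have "isCont b z" "isCont c z" using b c U by (auto simp: continuous_on_eq_continuous_at)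
  then obtain r1 r2 where r1: "r1 > 0" "\<And>w. dist w z < r1 \<Longrightarrow> dist (b w) (b z) < e"
    and r2: "r2 > 0" "\<And>w. dist w z < r2 \<Longrightarrow> dist (c w) (c z) < e"
    using e unfolding continuous_at_eps_delta by (metis dist_commute)
  \<comment> \<open>A point of the square with side \<open>h\<close> lies within 2\<open>h\<close>
    of \<open>z\<close>; dividing by 4 keeps this strictly below all three radii.\<close>
  define h where "h = min r0 (min r1 r2) / 4"
  have h: "h > 0" using r0 r1 r2 by (auto simp: h_def)
  have near: "dist (z + Complex s t) z < min r0 (min r1 r2)" if "0 \<le> s" "s \<le> h" "0 \<le> t" "t \<le> h" for s t
  proof -
    have "norm (Complex s t) \<le> \<bar>s\<bar> + \<bar>t\<bar>" using complex_norm cmod_le[of "Complex s t"] by simp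
    also have "\<dots> < min r0 (min r1 r2)" using that h by (simp add: h_def)
    finally show ?thesis by (simp add: dist_norm)
  qed
  have inU: "z + Complex s t \<in> U" if "0 \<le> s" "s \<le> h" "0 \<le> t" "t \<le> h" for s t
    using near[OF that] r0 by (auto simp: dist_commute)
  have dx: "((\<lambda>s. g (z + Complex s t)) has_real_derivative gx (z + Complex s t)) (at s)"
    if "(g has_derivative (\<lambda>h. Re h * gx (z + Complex s t) + Im h * gy (z + Complex s t))) (at (z + Complex s t))"
    for g gx gy s t
  proof -
    have "((\<lambda>s. z + Complex s t) has_derivative (\<lambda>h. of_real h)) (at s)"
      unfolding Complex_eq by (auto intro!: derivative_eq_intros)
    from diff_chain_at[OF this that] show ?thesis
      by (simp add: has_field_derivative_def o_def mult_commute_abs)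
  qed
  have dy: "((\<lambda>t. g (z + Complex s t)) has_real_derivative gy (z + Complex s t)) (at t)"
    if "(g has_derivative (\<lambda>h. Re h * gx (z + Complex s t) + Im h * gy (z + Complex s t))) (at (z + Complex s t))"
    for g gx gy s t
  proof -
    have "((\<lambda>t. z + Complex s t) has_derivative (\<lambda>h. \<i> * of_real h)) (at t)"
      unfolding Complex_eq by (auto intro!: derivative_eq_intros)
    from diff_chain_at[OF this that] show ?thesis
      by (simp add: has_field_derivative_def o_def mult_commute_abs)
  qed
  define F where "F s t = f (z + Complex s t)" for s t
  define P where "P s t = p (z + Complex s t)" for s t
  define Q where "Q s t = q (z + Complex s t)" for s t
  have Fx: "((\<lambda>s. F s t) has_real_derivative P s t) (at s)" if "0 \<le> s" "s \<le> h" "0 \<le> t" "t \<le> h" for s t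
    unfolding F_def P_def using dx[where g=f and gx=p and gy=q, OF f[OF inU[OF that]]] .
  have Fy: "((\<lambda>t. F s t) has_real_derivative Q s t) (at t)" if "0 \<le> s" "s \<le> h" "0 \<le> t" "t \<le> h" for s t
    unfolding F_def Q_def using dy[where g=f and gx=p and gy=q, OF f[OF inU[OF that]]] .
  have Py: "((\<lambda>t. P s t) has_real_derivative b (z + Complex s t)) (at t)" if "0 \<le> s" "s \<le> h" "0 \<le> t" "t \<le> h" for s t
    unfolding P_def using dy[where g=p and gx=a and gy=b, OF p[OF inU[OF that]]] .
  have Qx: "((\<lambda>s. Q s t) has_real_derivative c (z + Complex s t)) (at s)" if "0 \<le> s" "s \<le> h" "0 \<le> t" "t \<le> h" for s t
    unfolding Q_def using dx[where g=q and gx=c and gy=d, OF q[OF inU[OF that]]] .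
  \<comment> \<open>Grouping \<open>\<Delta>\<close> first in one variable and then in the other,
    and applying the mean value theorem twice in each case, gives the two expressions that are
    compared.\<close>
  define \<Delta> where "\<Delta> = F h h - F h 0 - F 0 h + F 0 0"
  have "\<exists>\<xi>>0. \<xi> < h \<and> (F h h - F h 0) - (F 0 h - F 0 0) = (h - 0) * (P \<xi> h - P \<xi> 0)"
    using h by (intro MVT2) (auto intro!: DERIV_diff Fx)
  then obtain s1 where s1: "0 < s1" "s1 < h" "\<Delta> = h * (P s1 h - P s1 0)" by (auto simp: \<Delta>_def)
  have "\<exists>\<eta>>0. \<eta> < h \<and> P s1 h - P s1 0 = (h - 0) * b (z + Complex s1 \<eta>)"
    using h s1 by (intro MVT2) (auto intro!: Py)
  then obtain t1 where t1: "0 < t1" "t1 < h" "\<Delta> = h * (h * b (z + Complex s1 t1))" using s1 by auto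
  have "\<exists>\<eta>>0. \<eta> < h \<and> (F h h - F 0 h) - (F h 0 - F 0 0) = (h - 0) * (Q h \<eta> - Q 0 \<eta>)"
    using h by (intro MVT2) (auto intro!: DERIV_diff Fy)
  then obtain t2 where t2: "0 < t2" "t2 < h" "\<Delta> = h * (Q h t2 - Q 0 t2)" by (auto simp: \<Delta>_def)
  have "\<exists>\<xi>>0. \<xi> < h \<and> Q h t2 - Q 0 t2 = (h - 0) * c (z + Complex \<xi> t2)"
    using h t2 by (intro MVT2) (auto intro!: Qx)
  then obtain s2 where s2: "0 < s2" "s2 < h" "\<Delta> = h * (h * c (z + Complex s2 t2))" using t2 by auto
  have eq: "b (z + Complex s1 t1) = c (z + Complex s2 t2)" using s2 t1 h by auto
  have "dist (b (z + Complex s1 t1)) (b z) < e" using near s1 t1 by (intro r1) auto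
  moreover have "dist (c (z + Complex s2 t2)) (c z) < e" using near s2 t2 by (intro r2) auto
  moreover have "dist (b z) (c z) \<le> dist (b (z + Complex s1 t1)) (b z) + dist (c (z + Complex s2 t2)) (c z)"
    using eq dist_triangle3 by metis
  ultimately show False by (simp add: e_def dist_real_def)
qed

text \<open>The function \<open>p - \<i> q\<close> satisfies the Cauchy-Riemann equations: one is
  the Laplace equation, the other the equality of the mixed partials. On a convex set it has a
  primitive, whose real part has the same differential as \<open>f\<close> and so differs from
  \<open>f\<close> by a constant.\<close>

lemma harmonic_is_Re_holomorphic:
  fixes f p q a b c d :: "complex \<Rightarrow> real"
  assumes U: "open U" "convex U"
    and f: "\<And>z. z \<in> U \<Longrightarrow> (f has_derivative (\<lambda>h. Re h * p z + Im h * q z)) (at z)"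
    and p: "\<And>z. z \<in> U \<Longrightarrow> (p has_derivative (\<lambda>h. Re h * a z + Im h * b z)) (at z)"
    and q: "\<And>z. z \<in> U \<Longrightarrow> (q has_derivative (\<lambda>h. Re h * c z + Im h * d z)) (at z)"
    and b: "continuous_on U b" and c: "continuous_on U c"
    and laplace: "\<And>z. z \<in> U \<Longrightarrow> a z + d z = 0"
  shows "\<exists>F. F holomorphic_on U \<and> (\<forall>z\<in>U. f z = Re (F z))"
proof -
  define g where "g w = complex_of_real (p w) - \<i> * of_real (q w)" for w
  have "(g has_field_derivative Complex (a z) (- b z)) (at z)" if z: "z \<in> U" for z
  proof -
    have bc: "b z = c z" by (rule mixed_partials_eq[OF U(1) z f p q b c])
    have da: "d z = - a z" using laplace[OF z] by simp
    have "(g has_derivative (\<lambda>h. of_real (Re h * a z + Im h * b z) - \<i> * of_real (Re h * c z + Im h * d z))) (at z)"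
      unfolding g_def
      by (intro has_derivative_diff has_derivative_mult_right has_derivative_of_real p q z)
    also have "(\<lambda>h. of_real (Re h * a z + Im h * b z) - \<i> * of_real (Re h * c z + Im h * d z)) = (*) (Complex (a z) (- b z))"
      using bc da by (auto simp: complex_eq_iff fun_eq_iff algebra_simps)
    finally show ?thesis by (simp add: has_field_derivative_def)
  qed
  then have "g holomorphic_on U"
    using holomorphic_on_open U by blast
  then obtain G where G: "\<And>z. z \<in> U \<Longrightarrow> (G has_field_derivative g z) (at z within U)"
    using holomorphic_convex_primitive'[OF U(2,1)] by metis
  have G': "(G has_field_derivative g z) (at z)" if "z \<in> U" for z
    using G[OF that] at_within_open[OF that U(1)] by simp
  have "((\<lambda>w. f w - Re (G w)) has_derivative (\<lambda>h. 0)) (at z within U)" if z: "z \<in> U" for z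
  proof -
    have "((\<lambda>w. Re (G w)) has_derivative (\<lambda>h. Re (g z * h))) (at z)"
      using has_derivative_Re[OF G'[OF z, unfolded has_field_derivative_def]] .
    from has_derivative_diff[OF f[OF z] this]
    have "((\<lambda>w. f w - Re (G w)) has_derivative (\<lambda>h. 0)) (at z)"
      by (simp add: g_def algebra_simps)
    then show ?thesis by (rule has_derivative_at_withinI)
  qed
  from has_derivative_zero_constant[OF U(2) this]
  obtain k where k: "\<And>z. z \<in> U \<Longrightarrow> f z - Re (G z) = k" by auto
  have "(\<lambda>z. G z + of_real k) holomorphic_on U"
    using G' U by (intro holomorphic_intros) (use holomorphic_on_open in blast)
  moreover have "\<forall>z\<in>U. f z = Re (G z + of_real k)" using k by force
  ultimately show ?thesis by blast
qed

text \<open>The \<open>F i\<close> are determined only up to imaginary constants, so they are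
  carried as a relation; every later use goes through the derivatives \<open>F i'\<close>, or
  through the real parts. With this encoding, the calculus of harmonic maps reduces to complex
  derivatives.\<close>

definition holomorphic_rep :: "complex set \<Rightarrow> (complex \<Rightarrow> real^'n) \<Rightarrow> ('n \<Rightarrow> complex \<Rightarrow> complex) \<Rightarrow> bool"
  where "holomorphic_rep U f F \<longleftrightarrow>
    (\<forall>i. F i holomorphic_on U) \<and> (\<forall>z\<in>U. f z = (\<chi> i. Re (F i z)))"

lemma holomorphic_rep_has_derivative:
  assumes "open U" "holomorphic_rep U f F" "z \<in> U"
  shows "(f has_derivative (\<lambda>h. \<chi> i. Re (deriv (F i) z * h))) (at z)"
proof -
  have "((\<lambda>w. \<chi> i. Re (F i w)) has_derivative (\<lambda>h. \<chi> i. Re (deriv (F i) z * h))) (at z)"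
  proof (rule has_derivative_vec_lambda)
    fix i
    have "(F i has_field_derivative deriv (F i) z) (at z)"
      using assms by (auto simp: holomorphic_rep_def intro: holomorphic_derivI)
    then show "((\<lambda>w. Re (F i w)) has_derivative (\<lambda>h. Re (deriv (F i) z * h))) (at z)"
      unfolding has_field_derivative_def by (rule has_derivative_Re)
  qed
  then show ?thesis
    by (rule has_derivative_transform_within_open[OF _ assms(1,3)])
       (use assms in \<open>auto simp: holomorphic_rep_def\<close>)
qed

text \<open>As \<open>f\<close> has differential h \<mapsto> Re (F' h), its partials are Re F' and
  Re (\<i> F'). They are again represented by holomorphic functions, so the lemma can be applied to
  its own output to reach second derivatives.\<close>

lemma holomorphic_rep_C1:
  assumes "open U" "holomorphic_rep U f F"
  shows "holomorphic_rep U (partial_x f) (\<lambda>i. deriv (F i))"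
    and "holomorphic_rep U (partial_y f) (\<lambda>i z. \<i> * deriv (F i) z)"
    and "C1_on U f"
proof -
  note D = partial_derivatives[OF holomorphic_rep_has_derivative[OF assms]]
  have hol: "deriv (F i) holomorphic_on U" for i
    using assms by (auto simp: holomorphic_rep_def intro: holomorphic_deriv)
  show x: "holomorphic_rep U (partial_x f) (\<lambda>i. deriv (F i))"
    using D hol by (auto simp: holomorphic_rep_def)
  show y: "holomorphic_rep U (partial_y f) (\<lambda>i z. \<i> * deriv (F i) z)"
    using D hol by (auto simp: holomorphic_rep_def intro!: holomorphic_on_mult)
  have cont: "continuous_on U g" if "holomorphic_rep U g G" for g :: "complex \<Rightarrow> real^'b" and G
    using partial_derivatives(3)[OF holomorphic_rep_has_derivative[OF assms(1) that]]
    by (meson continuous_at_imp_continuous_on differentiable_imp_continuous_within)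
  show "C1_on U f"
    using D(3) cont[OF x] cont[OF y] by (auto simp: C1_on_def)
qed

lemma harmonic_map_on_iff_rep:
  fixes f :: "complex \<Rightarrow> real^'n"
  assumes "open U" "convex U"
  shows "harmonic_map_on U f \<longleftrightarrow> (\<exists>F. holomorphic_rep U f F)"
proof
  assume H: "harmonic_map_on U f"
  have C: "C1_on U f" "C1_on U (partial_x f)" "C1_on U (partial_y f)"
    using H by (auto simp: harmonic_map_on_def C2_on_def)
  have "\<exists>F. F holomorphic_on U \<and> (\<forall>z\<in>U. f z $ i = Re (F z))" for i
  proof (rule harmonic_is_Re_holomorphic[OF assms])
    fix z assume z: "z \<in> U"
    show "((\<lambda>z. f z $ i) has_derivative (\<lambda>h. Re h * (partial_x f z $ i) + Im h * (partial_y f z $ i))) (at z)"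
      using has_derivative_vec_nth[OF C1_on_has_derivative[OF C(1) z], of i] by simp
    show "((\<lambda>z. partial_x f z $ i) has_derivative (\<lambda>h. Re h * (partial_x (partial_x f) z $ i)
        + Im h * (partial_y (partial_x f) z $ i))) (at z)"
      using has_derivative_vec_nth[OF C1_on_has_derivative[OF C(2) z], of i] by simp
    show "((\<lambda>z. partial_y f z $ i) has_derivative (\<lambda>h. Re h * (partial_x (partial_y f) z $ i)
        + Im h * (partial_y (partial_y f) z $ i))) (at z)"
      using has_derivative_vec_nth[OF C1_on_has_derivative[OF C(3) z], of i] by simp
    show "partial_x (partial_x f) z $ i + partial_y (partial_y f) z $ i = 0"
      using H z by (metis harmonic_map_on_def vector_add_component zero_index)
  qed (use C in \<open>auto simp: C1_on_def intro!: continuous_intros\<close>)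
  then obtain F where "\<And>i. F i holomorphic_on U \<and> (\<forall>z\<in>U. f z $ i = Re (F i z))" by metis
  then show "\<exists>F. holomorphic_rep U f F"
    by (auto simp: holomorphic_rep_def vec_eq_iff intro!: exI[of _ F])
next
  assume "\<exists>F. holomorphic_rep U f F"
  then obtain F where F: "holomorphic_rep U f F" ..
  note x = holomorphic_rep_C1(1)[OF assms(1) F] and y = holomorphic_rep_C1(2)[OF assms(1) F]
  have hol: "deriv (F i) holomorphic_on U" for i
    using assms F by (auto simp: holomorphic_rep_def intro: holomorphic_deriv)
  have "partial_x (partial_x f) z + partial_y (partial_y f) z = 0" if z: "z \<in> U" for z
  proof -
    \<comment> \<open>The second partials are Re F'' in x and Re (\<i> \<i> F'') = - Re F'' in y,
      hence cancel.\<close>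
    have "deriv (\<lambda>z. \<i> * deriv (F i) z) z = \<i> * deriv (deriv (F i)) z" for i
      using hol[of i] assms(1) z by (simp add: holomorphic_on_imp_differentiable_at)
    then show ?thesis
      using holomorphic_rep_C1(1)[OF assms(1) x] holomorphic_rep_C1(2)[OF assms(1) y] z
      by (simp add: holomorphic_rep_def vec_eq_iff)
  qed
  then show "harmonic_map_on U f"
    using holomorphic_rep_C1(3)[OF assms(1)] F x y by (auto simp: harmonic_map_on_def C2_on_def)
qed

text \<open>Here \<open>F\<^sub>i' = \<partial>\<^sub>x f\<^sub>i - \<i> \<partial>\<^sub>y f\<^sub>i\<close>, so the sum of squares is \<open>|f\<^sub>x|\<^sup>2 - |f\<^sub>y|\<^sup>2 - 2 \<i> f\<^sub>x \<bullet> f\<^sub>y\<close>.\<close>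

lemma conformal_map_on_iff_rep:
  fixes f :: "complex \<Rightarrow> real^'n"
  assumes "open U" "holomorphic_rep U f F"
  shows "conformal_map_on U f \<longleftrightarrow> (\<forall>z\<in>U. (\<Sum>i\<in>UNIV. (deriv (F i) z)\<^sup>2) = 0)"
proof -
  have "norm (partial_x f z) = norm (partial_y f z) \<and> partial_x f z \<bullet> partial_y f z = 0 \<longleftrightarrow>
      (\<Sum>i\<in>UNIV. (deriv (F i) z)\<^sup>2) = 0" if z: "z \<in> U" for z
  proof -
    have x: "partial_x f z = (\<chi> i. Re (deriv (F i) z))" and y: "partial_y f z = (\<chi> i. - Im (deriv (F i) z))"
      using holomorphic_rep_C1[OF assms] z by (auto simp: holomorphic_rep_def)
    have sq: "(w::complex)\<^sup>2 = Complex ((Re w)\<^sup>2 - (Im w)\<^sup>2) (2 * Re w * Im w)" for w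
      by (simp add: complex_eq_iff power2_eq_square)
    have "norm (partial_x f z) = norm (partial_y f z) \<longleftrightarrow>
        partial_x f z \<bullet> partial_x f z = partial_y f z \<bullet> partial_y f z"
      by (simp add: norm_eq)
    also have "\<dots> \<longleftrightarrow> (\<Sum>i\<in>UNIV. (Re (deriv (F i) z))\<^sup>2 - (Im (deriv (F i) z))\<^sup>2) = 0"
      by (simp add: x y inner_vec_def power2_eq_square sum_subtractf)
    finally have 1: "norm (partial_x f z) = norm (partial_y f z) \<longleftrightarrow> Re (\<Sum>i\<in>UNIV. (deriv (F i) z)\<^sup>2) = 0"
      by (simp add: sq)
    have "partial_x f z \<bullet> partial_y f z = - (\<Sum>i\<in>UNIV. Re (deriv (F i) z) * Im (deriv (F i) z))"
      by (simp add: x y inner_vec_def sum_negf)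
    moreover have "Im (\<Sum>i\<in>UNIV. (deriv (F i) z)\<^sup>2) = 2 * (\<Sum>i\<in>UNIV. Re (deriv (F i) z) * Im (deriv (F i) z))"
      by (simp add: sum_distrib_left mult.assoc mult.commute power2_eq_square)
    ultimately have "partial_x f z \<bullet> partial_y f z = 0 \<longleftrightarrow> Im (\<Sum>i\<in>UNIV. (deriv (F i) z)\<^sup>2) = 0"
      by simp
    then show ?thesis using 1 by (simp add: complex_eq_iff)
  qed
  then show ?thesis using holomorphic_rep_C1(3)[OF assms] by (auto simp: conformal_map_on_def)
qed

text \<open>Conformal harmonic discs are the real parts of holomorphic null curves: curves whose
  derivative lies in the null quadric. This is the description used to build discs and to
  reparametrize them.\<close>

lemma CH_iff_rep:
  fixes f :: "complex \<Rightarrow> real^'n"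
  shows "f \<in> CH \<Omega> \<longleftrightarrow> f ` unit_disc \<subseteq> \<Omega> \<and>
    (\<exists>F. holomorphic_rep unit_disc f F \<and> (\<forall>z\<in>unit_disc. (\<Sum>i\<in>UNIV. (deriv (F i) z)\<^sup>2) = 0))"
  using harmonic_map_on_iff_rep[of unit_disc f] conformal_map_on_iff_rep[of unit_disc f]
  by (auto simp: CH_def)

text \<open>The chain rule multiplies the sum of squares by the square of \<phi>', so it stays zero.
  No injectivity of \<phi> enters, because members of the class may have critical points.\<close>

lemma CH_compose:
  fixes f :: "complex \<Rightarrow> real^'n"
  assumes f: "f \<in> CH \<Omega>" and \<phi>: "\<phi> holomorphic_on unit_disc" "\<phi> ` unit_disc \<subseteq> unit_disc"
  shows "f \<circ> \<phi> \<in> CH \<Omega>"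
proof -
  obtain F where F: "holomorphic_rep unit_disc f F" "\<And>z. z \<in> unit_disc \<Longrightarrow> (\<Sum>i\<in>UNIV. (deriv (F i) z)\<^sup>2) = 0"
    and im: "f ` unit_disc \<subseteq> \<Omega>"
    using f by (auto simp: CH_iff_rep)
  have Fhol: "F i holomorphic_on unit_disc" for i using F by (auto simp: holomorphic_rep_def)
  have "holomorphic_rep unit_disc (f \<circ> \<phi>) (\<lambda>i. F i \<circ> \<phi>)"
    using F(1) \<phi> unfolding holomorphic_rep_def
    by (auto intro!: holomorphic_on_compose_gen[OF \<phi>(1)] simp: image_subset_iff simp del: mem_ball)
  moreover have "(\<Sum>i\<in>UNIV. (deriv (F i \<circ> \<phi>) z)\<^sup>2) = 0" if z: "z \<in> unit_disc" for z
  proof -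
    have \<phi>z: "\<phi> z \<in> unit_disc" using \<phi> z by blast
    have "deriv (F i \<circ> \<phi>) z = deriv (F i) (\<phi> z) * deriv \<phi> z" for i
      using Fhol[of i] \<phi>(1) z \<phi>z
      by (intro deriv_chain) (auto simp: holomorphic_on_imp_differentiable_at simp del: mem_ball)
    then show ?thesis using F(2)[OF \<phi>z] by (simp add: power_mult_distrib flip: sum_distrib_right)
  qed
  moreover have "(f \<circ> \<phi>) ` unit_disc \<subseteq> \<Omega>"
    using im \<phi> by (auto simp: image_subset_iff simp del: mem_ball)
  ultimately show ?thesis unfolding CH_iff_rep by blast
qed

lemma CH_const: "x \<in> \<Omega> \<Longrightarrow> (\<lambda>z. x) \<in> CH \<Omega>"
  for x :: "real^'n"
  unfolding CH_iff_rep holomorphic_rep_def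
  by (intro conjI exI[of _ "\<lambda>i z. of_real (x $ i)"]) auto

lemma CH_differentiable:
  assumes "f \<in> CH \<Omega>" "z \<in> unit_disc"
  shows "(f has_derivative frechet_derivative f (at z)) (at z)"
  using assms by (simp add: CH_def conformal_map_on_def C1_on_def flip: frechet_derivative_works)

subsection \<open>Comparison with the Poincare metric\<close>

lemma minimal_metric_le:
  assumes "f \<in> CH \<Omega>" "f 0 = x" "partial_x f 0 = r *\<^sub>R v" "r > 0"
  shows "minimal_metric \<Omega> x v \<le> ennreal (1 / r)"
  unfolding minimal_metric_def
proof (rule Inf_lower, rule CollectI, intro exI conjI)
  show "\<exists>f\<in>CH \<Omega>. f 0 = x \<and> partial_x f 0 = r *\<^sub>R v" using assms by blast
qed (use assms in simp_all)

text \<open>The constant disc satisfies f_x(0) = r 0 for every r > 0, so every 1/r competes in the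
  infimum.\<close>

lemma minimal_metric_zero:
  fixes x :: "real^'n"
  assumes "x \<in> \<Omega>"
  shows "minimal_metric \<Omega> x 0 = 0"
proof -
  have "minimal_metric \<Omega> x 0 \<le> 0 + ennreal e" if "e > 0" for e
  proof -
    have "partial_x (\<lambda>z::complex. x) 0 = 0"
      using partial_derivatives(1)[OF has_derivative_const] .
    then have "minimal_metric \<Omega> x 0 \<le> ennreal (1 / (1 / e))"
      using that by (intro minimal_metric_le[OF CH_const[OF assms]]) simp_all
    then show ?thesis by simp
  qed
  then have "minimal_metric \<Omega> x 0 \<le> 0" by (rule ennreal_le_epsilon)
  then show ?thesis by simp
qed

text \<open>Precompose \<open>f\<close> with the automorphism of the disc that sends 0 to
  \<open>z\<close> and whose derivative at 0 is a positive multiple \<open>r\<close> of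
  \<open>w\<close>. The reparametrized disc has x-derivative \<open>r\<close> times the image of
  \<open>w\<close>, and 1/\<open>r\<close> is the Poincare length of \<open>w\<close> at
  \<open>z\<close>.\<close>

lemma minimal_metric_le_Poincare:
  fixes f :: "complex \<Rightarrow> real^'n"
  assumes f: "f \<in> CH \<Omega>" and z: "z \<in> unit_disc"
  shows "minimal_metric \<Omega> (f z) (frechet_derivative f (at z) w) \<le> ennreal (norm w / (1 - (norm z)\<^sup>2))"
proof (cases "w = 0")
  case True
  have "f z \<in> \<Omega>" using f z by (auto simp: CH_def)
  then show ?thesis
    using True CH_differentiable[OF f z] by (simp add: linear_0 has_derivative_linear minimal_metric_zero)
next
  case False
  define D where "D = frechet_derivative f (at z)"
  have D: "(f has_derivative D) (at z)" unfolding D_def by (rule CH_differentiable[OF f z])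
  have zn: "norm z < 1" using z by simp
  then have z2: "(norm z)\<^sup>2 < 1" by (simp add: abs_square_less_1)
  \<comment> \<open>The rotation by \<open>sgn w\<close> turns the real direction at 0 into the
    direction of \<open>w\<close>; the Moebius map with parameter -z then moves 0 to
    \<open>z\<close>. The case \<open>w = 0\<close> was split off because \<open>sgn 0 = 0\<close>
    gives no rotation.\<close>
  define \<phi> where "\<phi> = Moebius_function 0 (-z) \<circ> (\<lambda>\<zeta>. sgn w * \<zeta>)"
  define r where "r = (1 - (norm z)\<^sup>2) / norm w"
  have r: "r > 0" using z2 False by (simp add: r_def)
  have rot: "(\<lambda>\<zeta>. sgn w * \<zeta>) ` unit_disc \<subseteq> unit_disc"
    using False by (auto simp: norm_mult norm_sgn)
  have "Moebius_function 0 (-z) ` unit_disc \<subseteq> unit_disc"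
    using Moebius_function_norm_lt_1[of "-z"] zn by auto
  then have \<phi>_im: "\<phi> ` unit_disc \<subseteq> unit_disc" using rot unfolding \<phi>_def image_comp[symmetric] by blast
  have \<phi>_hol: "\<phi> holomorphic_on unit_disc"
    unfolding \<phi>_def using zn rot
    by (intro holomorphic_on_compose_gen[OF _ Moebius_function_holomorphic]) (auto intro!: holomorphic_intros)
  have \<phi>0: "\<phi> 0 = z" by (simp add: \<phi>_def Moebius_function_def)
  have \<phi>_eq: "\<phi> = (\<lambda>\<zeta>. (sgn w * \<zeta> + z) / (1 + cnj z * (sgn w * \<zeta>)))"
    by (auto simp: \<phi>_def Moebius_function_def)
  have "(\<phi> has_field_derivative sgn w - z * (cnj z * sgn w)) (at 0)"
    unfolding \<phi>_eq by (auto intro!: derivative_eq_intros)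
  moreover have "sgn w - z * (cnj z * sgn w) = r *\<^sub>R w"
  proof -
    have "sgn w - z * (cnj z * sgn w) = sgn w * (1 - z * cnj z)" by (simp add: algebra_simps)
    also have "\<dots> = sgn w * of_real (1 - (norm z)\<^sup>2)" by (simp only: complex_norm_square of_real_diff of_real_1)
    also have "\<dots> = r *\<^sub>R w" by (simp add: sgn_eq r_def scaleR_conv_of_real)
    finally show ?thesis .
  qed
  ultimately have "(\<phi> has_derivative (*) (r *\<^sub>R w)) (at 0)"
    by (simp add: has_field_derivative_def)
  moreover have "(f has_derivative D) (at (\<phi> 0))" using D \<phi>0 by simp
  ultimately have "(f \<circ> \<phi> has_derivative D \<circ> (*) (r *\<^sub>R w)) (at 0)"
    by (rule diff_chain_at)
  from partial_derivatives(1)[OF this] have "partial_x (f \<circ> \<phi>) 0 = r *\<^sub>R D w"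
    by (simp add: linear_scale[OF has_derivative_linear[OF D]])
  moreover have "f \<circ> \<phi> \<in> CH \<Omega>" by (rule CH_compose[OF f \<phi>_hol \<phi>_im])
  moreover have "(f \<circ> \<phi>) 0 = f z" by (simp add: \<phi>0)
  moreover have "norm w / (1 - (norm z)\<^sup>2) = 1 / r" by (simp add: r_def)
  ultimately show ?thesis
    unfolding D_def[symmetric] using minimal_metric_le r by metis
qed

section \<open>Piecewise smooth paths traced by chains of discs\<close>

lemma smooth_on_interval_cong:
  assumes "smooth_on_interval a b f" "\<And>t. t \<in> {a..b} \<Longrightarrow> g t = f t"
  shows "smooth_on_interval a b g"
proof -
  obtain D where "\<forall>t\<in>{a..b}. D (0::nat) t = f t"
    and D: "\<forall>k. \<forall>t\<in>{a..b}. (D k has_vector_derivative D (Suc k) t) (at t within {a..b})"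
    using assms(1) unfolding smooth_on_interval_def by blast
  then have "\<forall>t\<in>{a..b}. D 0 t = g t" using assms(2) by metis
  with D show ?thesis unfolding smooth_on_interval_def by blast
qed

lemma smooth_on_interval_continuous:
  assumes "smooth_on_interval a b f"
  shows "continuous_on {a..b} f"
proof -
  obtain D where D: "\<And>t. t \<in> {a..b} \<Longrightarrow> D (0::nat) t = f t"
    "\<And>k t. t \<in> {a..b} \<Longrightarrow> (D k has_vector_derivative D (Suc k) t) (at t within {a..b})"
    using assms unfolding smooth_on_interval_def by blast
  have "continuous_on {a..b} (D 0)"
    using D(2)[of _ 0] has_vector_derivative_continuous continuous_on_eq_continuous_within by blast
  then show ?thesis using D(1) continuous_on_cong[OF refl, of "{a..b}" "D 0" f] by blast
qed

text \<open>Along an affine path with velocity \<open>q\<close>, the k-th derivative of F is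
  \<open>q ^ k\<close> times its k-th complex derivative. This explicit family witnesses smoothness
  up to the endpoints, since they too are mapped into the open set \<open>U\<close>.\<close>

lemma holomorphic_rep_smooth_on_interval:
  fixes f :: "complex \<Rightarrow> real^'n"
  assumes U: "open U" and F: "holomorphic_rep U f F" and \<gamma>: "\<And>t. t \<in> {a..b} \<Longrightarrow> p + of_real t * q \<in> U"
  shows "smooth_on_interval a b (\<lambda>t. f (p + of_real t * q))"
  unfolding smooth_on_interval_def
proof (intro exI[of _ "\<lambda>k t. \<chi> i. Re (q ^ k * (deriv ^^ k) (F i) (p + of_real t * q))"] conjI allI ballI)
  fix t assume t: "t \<in> {a..b}"
  show "(\<chi> i. Re (q ^ 0 * (deriv ^^ 0) (F i) (p + of_real t * q))) = f (p + of_real t * q)"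
    using F \<gamma>[OF t] by (simp add: holomorphic_rep_def)
next
  fix k t assume t: "t \<in> {a..b}"
  have "((\<lambda>t. Re (q ^ k * (deriv ^^ k) (F i) (p + of_real t * q))) has_derivative
      (\<lambda>h. h * Re (q ^ Suc k * (deriv ^^ Suc k) (F i) (p + of_real t * q)))) (at t)" for i
  proof -
    have "F i holomorphic_on U" using F by (simp add: holomorphic_rep_def)
    then have "(deriv ^^ k) (F i) holomorphic_on U" using U by (rule holomorphic_higher_deriv)
    then have "((deriv ^^ k) (F i) has_field_derivative (deriv ^^ Suc k) (F i) (p + of_real t * q)) (at (p + of_real t * q))"
      using U \<gamma>[OF t] by (simp add: holomorphic_derivI)
    then have 1: "((\<lambda>w. q ^ k * (deriv ^^ k) (F i) w) has_field_derivative q ^ k * (deriv ^^ Suc k) (F i) (p + of_real t * q)) (at (p + of_real t * q))"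
      by (rule DERIV_cmult)
    have 2: "((\<lambda>t. p + of_real t * q) has_vector_derivative q) (at t)"
      by (auto intro!: derivative_eq_intros simp: has_vector_derivative_def scaleR_conv_of_real)
    from bounded_linear.has_vector_derivative[OF bounded_linear_Re field_vector_diff_chain_at[OF 2 1]]
    show ?thesis by (simp add: has_vector_derivative_def o_def mult.assoc mult.left_commute)
  qed
  then have "((\<lambda>t. \<chi> i. Re (q ^ k * (deriv ^^ k) (F i) (p + of_real t * q))) has_derivative
      (\<lambda>h. \<chi> i. h * Re (q ^ Suc k * (deriv ^^ Suc k) (F i) (p + of_real t * q)))) (at t)"
    by (rule has_derivative_vec_lambda)
  also have "(\<lambda>h. \<chi> i. h * Re (q ^ Suc k * (deriv ^^ Suc k) (F i) (p + of_real t * q)))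
     = (\<lambda>h. h *\<^sub>R (\<chi> i. Re (q ^ Suc k * (deriv ^^ Suc k) (F i) (p + of_real t * q))))"
    by (simp add: vec_eq_iff fun_eq_iff)
  finally show "((\<lambda>t. \<chi> i. Re (q ^ k * (deriv ^^ k) (F i) (p + of_real t * q))) has_vector_derivative
     (\<chi> i. Re (q ^ Suc k * (deriv ^^ Suc k) (F i) (p + of_real t * q)))) (at t within {a..b})"
    unfolding has_vector_derivative_def by (rule has_derivative_at_withinI)
qed

lemma mono_partition:
  fixes s :: "nat \<Rightarrow> real"
  assumes "\<forall>i<N. s i < s (Suc i)" "i \<le> j" "j \<le> N"
  shows "s i \<le> s j"
  using assms(2,3)
proof (induction j rule: dec_induct)
  case (step n)
  then have "s n < s (Suc n)" using assms(1) by auto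
  with step show ?case by auto
qed auto

lemma continuous_on_partition:
  fixes s :: "nat \<Rightarrow> real"
  assumes "\<forall>i<N. s i < s (Suc i)" "\<And>i. i < N \<Longrightarrow> continuous_on {s i..s (Suc i)} f"
  shows "continuous_on {s 0..s N} f"
proof -
  have "n \<le> N \<Longrightarrow> continuous_on {s 0..s n} f" for n
  proof (induction n)
    case (Suc n)
    have "{s 0..s (Suc n)} = {s 0..s n} \<union> {s n..s (Suc n)}"
      using mono_partition[OF assms(1), of 0 n] assms(1) Suc.prems
      by (intro ivl_disj_un_two_touch(4)[symmetric]) (auto intro: less_imp_le)
    then show ?case using Suc assms(2)[of n] by (auto intro!: continuous_on_closed_Un)
  qed auto
  then show ?thesis by simp
qed

lemma partition_cases:
  fixes s :: "nat \<Rightarrow> real"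
  assumes "t \<in> {s 0..s N}" "t \<notin> s ` {..N}"
  obtains i where "i < N" "t \<in> {s i<..<s (Suc i)}"
proof -
  define i where "i = (LEAST n. t \<le> s n)"
  have t: "t \<le> s N" using assms by auto
  have i: "t \<le> s i" "i \<le> N" unfolding i_def using t by (auto intro: LeastI Least_le)
  have "i \<noteq> 0" using i assms by (cases "i = 0") auto
  then obtain j where j: "i = Suc j" using not0_implies_Suc by blast
  then have "\<not> t \<le> s j" using not_less_Least[of j "\<lambda>n. t \<le> s n"] unfolding i_def by simp
  moreover have "t \<noteq> s i" using i assms by auto
  ultimately show thesis using i j by (intro that[of j]) auto
qed

text \<open>Join the images of the radii from 0 to \<open>a i\<close> under the discs, spending time
  1/k on each. By the Poincare bound, the integrand is at most the hyperbolic speed of the radius,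
  whose integral is the corresponding term of the chain length.\<close>

lemma minimal_distance_le_chain:
  fixes x :: "real^'n"
  assumes "disc_chain \<Omega> x y k f a"
  shows "minimal_distance \<Omega> x y \<le> ennreal (chain_length k a)"
proof -
  have k: "k \<ge> 1" and f: "\<And>i. i < k \<Longrightarrow> f (Suc i) \<in> CH \<Omega>"
    and a: "\<And>i. i < k \<Longrightarrow> norm (a (Suc i)) < 1"
    and start: "f 1 0 = x" and fin: "f k (a k) = y"
    and link: "\<And>i. Suc i < k \<Longrightarrow> f (Suc (Suc i)) 0 = f (Suc i) (a (Suc i))"
    using assms by (auto simp: disc_chain_def)
  define s where "s i = real i / real k" for i
  \<comment> \<open>On the i-th subinterval \<open>z i\<close> runs along the radius from 0 to
    \<open>a (Suc i)\<close>; the form p + t q is the one required for smoothness along affine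
    paths. Subintervals count from 0, discs from 1.\<close>
  define z where "z i t = - (real i *\<^sub>R a (Suc i)) + of_real t * (real k *\<^sub>R a (Suc i))" for i t
  have z: "z i t = (real k * t - real i) *\<^sub>R a (Suc i)" for i t
    by (simp add: z_def scaleR_conv_of_real algebra_simps)
  \<comment> \<open>The index of the subinterval containing \<open>t\<close>; the minimum matters
    only at the right end, where the floor would give \<open>k\<close>.\<close>
  define j where "j t = min (k - 1) (nat \<lfloor>real k * t\<rfloor>)" for t
  define \<gamma> where "\<gamma> t = f (Suc (j t)) (z (j t) t)" for t
  have s: "\<forall>i<k. s i < s (Suc i)" using k by (simp add: s_def divide_simps)
  have s_ends: "s 0 = 0" "s k = 1" using k by (auto simp: s_def)
  have seg: "0 \<le> real k * t - real i" "real k * t - real i \<le> 1" if "t \<in> {s i..s (Suc i)}" for i t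
    using that k by (auto simp: s_def field_simps)
  have z_disc: "z i t \<in> unit_disc" and z_norm: "norm (z i t) = (real k * t - real i) * norm (a (Suc i))"
    if "t \<in> {s i..s (Suc i)}" "i < k" for i t
  proof -
    show n: "norm (z i t) = (real k * t - real i) * norm (a (Suc i))"
      using seg[OF that(1)] by (simp add: z)
    have "(real k * t - real i) * norm (a (Suc i)) \<le> 1 * norm (a (Suc i))"
      using seg[OF that(1)] by (intro mult_right_mono) auto
    then show "z i t \<in> unit_disc" using n a[OF that(2)] by simp
  qed
  have \<gamma>_eq: "\<gamma> t = f (Suc i) (z i t)" if t: "t \<in> {s i..s (Suc i)}" and i: "i < k" for i t
  \<comment> \<open>At an inner right endpoint, the definition of \<gamma> already uses the next
    disc, at its centre; the linking condition identifies that value with the end of the present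
    radius.\<close>
  proof (cases "t = s (Suc i)")
    case True
    then have kt: "real k * t = real (Suc i)" using k by (simp add: s_def)
    then have "nat \<lfloor>real k * t\<rfloor> = Suc i" by simp
    then have jt: "j t = min (k - 1) (Suc i)" by (simp add: j_def)
    show ?thesis
    proof (cases "Suc i < k")
      case True
      then have "j t = Suc i" using jt by simp
      then show ?thesis using link[OF True] kt by (simp add: \<gamma>_def z)
    next
      case False
      then have "j t = i" using jt i by simp
      then show ?thesis by (simp add: \<gamma>_def)
    qed
  next
    case False
    then have "t < s (Suc i)" using t by auto
    then have "real i \<le> real k * t" "real k * t < real i + 1" using t k by (auto simp: s_def field_simps)
    then have "\<lfloor>real k * t\<rfloor> = int i" by (simp add: floor_unique)
    then have "j t = i" using i by (simp add: j_def)
    then show ?thesis by (simp add: \<gamma>_def)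
  qed
  have smooth: "smooth_on_interval (s i) (s (Suc i)) \<gamma>" if i: "i < k" for i
  proof -
    obtain F where F: "holomorphic_rep unit_disc (f (Suc i)) F" using f[OF i] by (auto simp: CH_iff_rep)
    have "smooth_on_interval (s i) (s (Suc i)) (\<lambda>t. f (Suc i) (z i t))"
      unfolding z_def by (rule holomorphic_rep_smooth_on_interval[OF _ F]) (use z_disc i in \<open>auto simp: z_def\<close>)
    then show ?thesis by (rule smooth_on_interval_cong) (use \<gamma>_eq i in auto)
  qed
  have in\<Omega>: "f (Suc i) w \<in> \<Omega>" if "i < k" "w \<in> unit_disc" for i w
    using f[OF that(1)] that(2) by (auto simp: CH_def)
  have s_0: "s i \<in> {s i..s (Suc i)}" "s (Suc i) \<in> {s i..s (Suc i)}" if "i < k" for i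
    using s that by (auto intro: less_imp_le)
  have paths: "\<gamma> \<in> piecewise_smooth_paths_in \<Omega> x y"
  proof -
    have "path \<gamma>"
      using continuous_on_partition[OF s, of \<gamma>] smooth smooth_on_interval_continuous
      unfolding path_def s_ends by blast
    moreover have "piecewise_smooth_path \<gamma>"
      unfolding piecewise_smooth_path_def using \<open>path \<gamma>\<close> s s_ends smooth by blast
    moreover have "\<gamma> t \<in> \<Omega>" if t: "t \<in> {0..1}" for t
    proof -
      have "\<exists>i<k. t \<in> {s i..s (Suc i)}"
      proof (cases "t \<in> s ` {..k}")
        case True
        then obtain i where i: "i \<le> k" "t = s i" by auto
        show ?thesis
        proof (cases "i = k")
          case True
          then show ?thesis using i k s_0[of "k - 1"] by (intro exI[of _ "k - 1"]) auto
        next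
          case False
          then show ?thesis using i s_0[of i] by (intro exI[of _ i]) auto
        qed
      next
        case False
        then obtain i where "i < k" "t \<in> {s i<..<s (Suc i)}"
          using t partition_cases[of t s k] unfolding s_ends by blast
        then show ?thesis by (intro exI[of _ i]) auto
      qed
      then show ?thesis using \<gamma>_eq in\<Omega> z_disc by metis
    qed
    moreover have "\<gamma> 0 = x"
      using \<gamma>_eq[of 0 0] k start s_0[of 0] s_ends by (simp add: z)
    moreover have "\<gamma> 1 = y"
    proof -
      have "Suc (k - 1) = k" using k by simp
      then show ?thesis using \<gamma>_eq[of 1 "k - 1"] k fin s_0[of "k - 1"] s_ends by (simp add: z)
    qed
    ultimately show ?thesis
      by (auto simp: piecewise_smooth_paths_in_def path_image_def pathstart_def pathfinish_def)
  qed
  define h where "h i t = real k * norm (a (Suc i)) / (1 - ((real k * t - real i) * norm (a (Suc i)))\<^sup>2)" for i t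
  have bound: "minimal_metric \<Omega> (\<gamma> t) (vector_derivative \<gamma> (at t)) \<le> ennreal (h i t)"
    if i: "i < k" and t: "t \<in> {s i<..<s (Suc i)}" for i t
  proof -
    have t': "t \<in> {s i..s (Suc i)}" using t by auto
    define D where "D = frechet_derivative (f (Suc i)) (at (z i t))"
    have D: "(f (Suc i) has_derivative D) (at (z i t))"
      unfolding D_def by (rule CH_differentiable[OF f[OF i] z_disc[OF t' i]])
    have "((\<lambda>t. z i t) has_derivative (\<lambda>h. h *\<^sub>R (real k *\<^sub>R a (Suc i)))) (at t)"
      unfolding z_def by (auto intro!: derivative_eq_intros simp: scaleR_conv_of_real)
    from diff_chain_at[OF this D]
    have "((\<lambda>t. f (Suc i) (z i t)) has_vector_derivative D (real k *\<^sub>R a (Suc i))) (at t)"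
      by (simp add: has_vector_derivative_def o_def linear_scale[OF has_derivative_linear[OF D]])
    then have "(\<gamma> has_vector_derivative D (real k *\<^sub>R a (Suc i))) (at t)"
      by (rule has_vector_derivative_transform_within_open[OF _ _ t]) (use \<gamma>_eq[symmetric] i in auto)
    then have "vector_derivative \<gamma> (at t) = D (real k *\<^sub>R a (Suc i))"
      by (rule vector_derivative_at)
    moreover have "minimal_metric \<Omega> (f (Suc i) (z i t)) (D (real k *\<^sub>R a (Suc i)))
       \<le> ennreal (norm (real k *\<^sub>R a (Suc i)) / (1 - (norm (z i t))\<^sup>2))"
      unfolding D_def by (rule minimal_metric_le_Poincare[OF f[OF i] z_disc[OF t' i]])
    ultimately show ?thesis
      using \<gamma>_eq[OF t' i] z_norm[OF t' i] by (simp add: h_def)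
  qed
  have int: "(\<integral>\<^sup>+t. ennreal (h i t) * indicator {s i..s (Suc i)} t \<partial>lborel)
      = ennreal (1/2 * ln ((1 + norm (a (Suc i))) / (1 - norm (a (Suc i)))))" if i: "i < k" for i
  proof -
    define \<alpha> where "\<alpha> = norm (a (Suc i))"
    have \<alpha>: "0 \<le> \<alpha>" "\<alpha> < 1" using a[OF i] by (auto simp: \<alpha>_def)
    \<comment> \<open>The primitive of \<open>h i\<close>: the inverse hyperbolic tangent of the
      distance of \<open>z i t\<close> from the origin.\<close>
    define G where "G t = 1/2 * (ln (1 + (real k * t - real i) * \<alpha>) - ln (1 - (real k * t - real i) * \<alpha>))" for t
    have b: "0 \<le> (real k * t - real i) * \<alpha>" "(real k * t - real i) * \<alpha> < 1" if "t \<in> {s i..s (Suc i)}" for t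
    proof -
      show "0 \<le> (real k * t - real i) * \<alpha>" using seg[OF that] \<alpha> by simp
      have "(real k * t - real i) * \<alpha> \<le> 1 * \<alpha>" using seg[OF that] \<alpha> by (intro mult_right_mono) auto
      then show "(real k * t - real i) * \<alpha> < 1" using \<alpha> by simp
    qed
    have "(\<integral>\<^sup>+t. ennreal (h i t) * indicator {s i..s (Suc i)} t \<partial>lborel) = G (s (Suc i)) - G (s i)"
    proof (rule nn_integral_FTC_Icc)
      show "h i \<in> borel_measurable borel" unfolding h_def by measurable
      fix t assume t: "t \<in> {s i..s (Suc i)}"
      define u where "u = (real k * t - real i) * \<alpha>"
      have u: "0 \<le> u" "u < 1" using b[OF t] by (auto simp: u_def)
      have "u\<^sup>2 < 1" using u by (simp add: abs_square_less_1)
      then show "0 \<le> h i t" by (simp add: h_def u_def \<alpha>_def)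
      have "((\<lambda>t. ln (1 + (real k * t - real i) * \<alpha>)) has_real_derivative real k * \<alpha> / (1 + u)) (at t)"
        using b[OF t] by (auto intro!: derivative_eq_intros simp: u_def)
      moreover have "((\<lambda>t. ln (1 - (real k * t - real i) * \<alpha>)) has_real_derivative - (real k * \<alpha>) / (1 - u)) (at t)"
        using b[OF t] by (auto intro!: derivative_eq_intros simp: u_def)
      ultimately have "(G has_real_derivative 1/2 * (real k * \<alpha> / (1 + u) - - (real k * \<alpha>) / (1 - u))) (at t)"
        unfolding G_def by (intro DERIV_cmult DERIV_diff)
      also have "1/2 * (real k * \<alpha> / (1 + u) - - (real k * \<alpha>) / (1 - u)) = real k * \<alpha> / (1 - u\<^sup>2)"
      proof -
        have "1 - u\<^sup>2 = (1 + u) * (1 - u)" by (simp add: power2_eq_square algebra_simps)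
        then show ?thesis using u by (simp add: field_simps)
      qed
      also have "\<dots> = h i t" by (simp add: h_def u_def \<alpha>_def)
      finally show "(G has_real_derivative h i t) (at t)" .
    qed (use s i in \<open>auto intro: less_imp_le\<close>)
    also have "G (s (Suc i)) - G (s i) = 1/2 * ln ((1 + \<alpha>) / (1 - \<alpha>))"
      using \<alpha> k by (simp add: G_def s_def ln_div)
    finally show ?thesis by (simp add: \<alpha>_def)
  qed
  \<comment> \<open>Nothing is known about \<open>vector_derivative\<close> at the break points;
    they form a finite set and do not affect the integral.\<close>
  have "AE t in lborel. t \<notin> s ` {..k}"
    by (intro AE_not_in finite_imp_null_set_lborel) auto
  then have "AE t in lborel. minimal_metric \<Omega> (\<gamma> t) (vector_derivative \<gamma> (at t)) * indicator {0..1} t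
       \<le> (\<Sum>i<k. ennreal (h i t) * indicator {s i..s (Suc i)} t)"
  proof (rule AE_mp, intro AE_I2 impI)
    fix t assume t: "t \<notin> s ` {..k}"
    show "minimal_metric \<Omega> (\<gamma> t) (vector_derivative \<gamma> (at t)) * indicator {0..1} t
       \<le> (\<Sum>i<k. ennreal (h i t) * indicator {s i..s (Suc i)} t)"
    proof (cases "t \<in> {0..1}")
      case True
      then obtain i where i: "i < k" "t \<in> {s i<..<s (Suc i)}"
        using t partition_cases[of t s k] unfolding s_ends by blast
      have "minimal_metric \<Omega> (\<gamma> t) (vector_derivative \<gamma> (at t)) * indicator {0..1} t
        \<le> ennreal (h i t) * indicator {s i..s (Suc i)} t"
        using bound[OF i] True i by simp
      also have "\<dots> \<le> (\<Sum>i<k. ennreal (h i t) * indicator {s i..s (Suc i)} t)"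
        using i by (intro member_le_sum) auto
      finally show ?thesis .
    qed auto
  qed
  then have "(\<integral>\<^sup>+t\<in>{0..1}. minimal_metric \<Omega> (\<gamma> t) (vector_derivative \<gamma> (at t)) \<partial>lborel)
      \<le> (\<integral>\<^sup>+t. (\<Sum>i<k. ennreal (h i t) * indicator {s i..s (Suc i)} t) \<partial>lborel)"
    by (rule nn_integral_mono_AE)
  also have "\<dots> = (\<Sum>i<k. \<integral>\<^sup>+t. ennreal (h i t) * indicator {s i..s (Suc i)} t \<partial>lborel)"
    unfolding h_def by (intro nn_integral_sum) measurable
  also have "\<dots> = (\<Sum>i<k. ennreal (1/2 * ln ((1 + norm (a (Suc i))) / (1 - norm (a (Suc i))))))"
    using int by simp
  also have "\<dots> = ennreal (\<Sum>i<k. 1/2 * ln ((1 + norm (a (Suc i))) / (1 - norm (a (Suc i)))))"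
    using a by (intro sum_ennreal) (auto intro!: mult_nonneg_nonneg ln_ge_zero simp: divide_simps)
  also have "\<dots> = ennreal (chain_length k a)"
    unfolding chain_length_def by (simp add: sum.atLeast1_atMost_eq)
  finally show ?thesis
    unfolding minimal_distance_def using paths by (rule INF_lower2[rotated])
qed

lemma minimal_distance_le_chain_distance:
  fixes x :: "real^'n"
  shows "minimal_distance \<Omega> x y \<le> chain_distance \<Omega> x y"
  unfolding chain_distance_def by (rule Inf_greatest) (auto intro: minimal_distance_le_chain)

subsection \<open>The chain pseudodistance\<close>

text \<open>From ln x \<le> x - 1 the left side is at most s / (1 - s), and 1 - s \<ge> 1/2. It
  makes the hyperbolic length of a short radius linear in its Euclidean length.\<close>

lemma half_ln_ratio_le:
  fixes s :: real
  assumes "0 \<le> s" "s \<le> 1/2"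
  shows "1/2 * ln ((1 + s) / (1 - s)) \<le> 2 * s"
proof -
  have "ln ((1 + s) / (1 - s)) \<le> (1 + s) / (1 - s) - 1"
    using assms by (intro ln_le_minus_one) simp
  also have "\<dots> = 2 * s / (1 - s)" using assms by (simp add: field_simps)
  also have "\<dots> \<le> 2 * s / (1 / 2)" using assms by (intro divide_left_mono) auto
  finally show ?thesis by simp
qed

lemma chain_distance_le:
  assumes "disc_chain \<Omega> x y k f a"
  shows "chain_distance \<Omega> x y \<le> ennreal (chain_length k a)"
  unfolding chain_distance_def using assms by (intro Inf_lower) blast

lemma chain_distance_le_disc:
  assumes "f \<in> CH \<Omega>" "a \<in> unit_disc"
  shows "chain_distance \<Omega> (f 0) (f a) \<le> ennreal (1/2 * ln ((1 + norm a) / (1 - norm a)))"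
proof -
  have "disc_chain \<Omega> (f 0) (f a) 1 (\<lambda>_. f) (\<lambda>_. a)"
    using assms by (simp add: disc_chain_def)
  from chain_distance_le[OF this] show ?thesis by (simp add: chain_length_def)
qed

lemma chain_length_nonneg:
  assumes "disc_chain \<Omega> x y k f a"
  shows "0 \<le> chain_length k a"
  unfolding chain_length_def
proof (rule sum_nonneg)
  fix i assume "i \<in> {1..k}"
  then have "norm (a i) < 1" using assms by (auto simp: disc_chain_def)
  then show "0 \<le> 1/2 * ln ((1 + norm (a i)) / (1 - norm (a i)))"
    by (intro mult_nonneg_nonneg ln_ge_zero) (auto simp: divide_simps)
qed

lemma disc_chain_append:
  assumes f: "disc_chain \<Omega> x y k f a" and g: "disc_chain \<Omega> y z l g b"
  defines "h \<equiv> \<lambda>i. if i \<le> k then f i else g (i - k)"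
    and "c \<equiv> \<lambda>i. if i \<le> k then a i else b (i - k)"
  shows "disc_chain \<Omega> x z (k + l) h c" "chain_length (k + l) c = chain_length k a + chain_length l b"
proof -
  have kl: "k \<ge> 1" "l \<ge> 1" using f g by (auto simp: disc_chain_def)
  show "disc_chain \<Omega> x z (k + l) h c"
    unfolding disc_chain_def
  proof (intro conjI ballI)
    show "1 \<le> k + l" using kl by simp
    fix i assume i: "i \<in> {1..k + l}"
    have "h i \<in> CH \<Omega> \<and> c i \<in> unit_disc"
    proof (cases "i \<le> k")
      case True
      then show ?thesis using f i by (simp add: disc_chain_def h_def c_def)
    next
      case False
      then have "i - k \<in> {1..l}" using i by auto
      then show ?thesis using False g by (simp add: disc_chain_def h_def c_def)
    qed
    then show "h i \<in> CH \<Omega>" "c i \<in> unit_disc" by auto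
  next
    show "h 1 0 = x" using f kl by (simp add: disc_chain_def h_def)
    show "h (k + l) (c (k + l)) = z" using g kl by (simp add: disc_chain_def h_def c_def)
    fix i assume i: "i \<in> {1..<k + l}"
    consider "i < k" | "i = k" | "k < i" by linarith
    then show "h (i + 1) 0 = h i (c i)"
    proof cases
      case 1
      then show ?thesis using f i by (simp add: disc_chain_def h_def c_def)
    next
      case 2
      then show ?thesis using f g by (simp add: disc_chain_def h_def c_def)
    next
      case 3
      then have "i - k \<in> {1..<l}" using i by auto
      then have "g ((i - k) + 1) 0 = g (i - k) (b (i - k))"
        using g unfolding disc_chain_def by blast
      then show ?thesis using 3 by (simp add: h_def c_def Suc_diff_le)
    qed
  qed
  define L where "L w = 1/2 * ln ((1 + norm w) / (1 - norm w))" for w :: complex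
  have "chain_length (k + l) c = (\<Sum>i<k + l. L (c (Suc i)))"
    by (simp add: chain_length_def sum.atLeast1_atMost_eq L_def)
  also have "\<dots> = (\<Sum>i<k. L (c (Suc i))) + (\<Sum>i<l. L (c (Suc (k + i))))"
  proof (induction l)
    case (Suc l)
    then show ?case by simp
  qed simp
  also have "(\<Sum>i<k. L (c (Suc i))) = (\<Sum>i<k. L (a (Suc i)))"
    by (intro sum.cong) (auto simp: c_def)
  also have "(\<Sum>i<l. L (c (Suc (k + i)))) = (\<Sum>i<l. L (b (Suc i)))"
    by (intro sum.cong) (auto simp: c_def)
  finally show "chain_length (k + l) c = chain_length k a + chain_length l b"
    by (simp add: chain_length_def sum.atLeast1_atMost_eq L_def)
qed

lemma chain_distance_triangle:
  "chain_distance \<Omega> x z \<le> chain_distance \<Omega> x y + chain_distance \<Omega> y z"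
proof (rule ennreal_le_epsilon)
  fix e :: real
  assume fin: "chain_distance \<Omega> x y + chain_distance \<Omega> y z < top" and e: "0 < e"
  \<comment> \<open>Finiteness makes c < c + e/2 strict, so that some chain has length below the
    right side.\<close>
  have close: "\<exists>k f a. disc_chain \<Omega> p q k f a \<and> ennreal (chain_length k a) < chain_distance \<Omega> p q + ennreal (e / 2)"
    if "chain_distance \<Omega> p q < top" for p q
  proof -
    define S where "S = {ennreal (chain_length k a) |k f a. disc_chain \<Omega> p q k f a}"
    have "Inf S = chain_distance \<Omega> p q" by (simp add: S_def chain_distance_def)
    moreover have "chain_distance \<Omega> p q < chain_distance \<Omega> p q + ennreal (e / 2)"
      using that e ennreal_add_left_cancel_less[of "chain_distance \<Omega> p q" 0 "ennreal (e / 2)"] by simp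
    ultimately have "Inf S < chain_distance \<Omega> p q + ennreal (e / 2)" by simp
    then show ?thesis unfolding Inf_less_iff S_def by blast
  qed
  obtain k f a where 1: "disc_chain \<Omega> x y k f a" "ennreal (chain_length k a) < chain_distance \<Omega> x y + ennreal (e / 2)"
    using close[OF le_less_trans[OF _ fin], of x y] by auto
  obtain l g b where 2: "disc_chain \<Omega> y z l g b" "ennreal (chain_length l b) < chain_distance \<Omega> y z + ennreal (e / 2)"
    using close[OF le_less_trans[OF _ fin], of y z] by auto
  have "chain_distance \<Omega> x z \<le> ennreal (chain_length k a + chain_length l b)"
    using chain_distance_le[OF disc_chain_append(1)[OF 1(1) 2(1)]] disc_chain_append(2)[OF 1(1) 2(1)] by simp
  also have "\<dots> = ennreal (chain_length k a) + ennreal (chain_length l b)"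
    using chain_length_nonneg[OF 1(1)] chain_length_nonneg[OF 2(1)] by simp
  also have "\<dots> \<le> (chain_distance \<Omega> x y + ennreal (e / 2)) + (chain_distance \<Omega> y z + ennreal (e / 2))"
    using 1 2 by (intro add_mono) auto
  also have "\<dots> = chain_distance \<Omega> x y + chain_distance \<Omega> y z + (ennreal (e / 2) + ennreal (e / 2))"
    by (simp add: ac_simps)
  also have "ennreal (e / 2) + ennreal (e / 2) = ennreal e"
    using e by (simp flip: ennreal_plus)
  finally show "chain_distance \<Omega> x z \<le> chain_distance \<Omega> x y + chain_distance \<Omega> y z + ennreal e" .
qed

text \<open>The flat round disc of radius \<open>d\<close> in the plane of \<open>e1\<close> and
  \<open>e2\<close>. Its representing functions are affine with coefficients d (e1_i - \<i> e2_i), a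
  null vector because \<open>e1\<close>, \<open>e2\<close> are orthonormal; the image stays in the
  ball because the linear part is \<open>d\<close> times an isometry.\<close>

lemma affine_disc_in_CH:
  fixes p e1 e2 :: "real^'n"
  assumes d: "d > 0" "ball p d \<subseteq> \<Omega>" and e: "norm e1 = 1" "norm e2 = 1" "e1 \<bullet> e2 = 0"
  shows "(\<lambda>z. p + d *\<^sub>R (Re z *\<^sub>R e1 + Im z *\<^sub>R e2)) \<in> CH \<Omega>"
  unfolding CH_iff_rep
proof (intro conjI exI)
  define c where "c i = complex_of_real d * Complex (e1 $ i) (- (e2 $ i))" for i
  let ?F = "\<lambda>i z. complex_of_real (p $ i) + c i * z"
  show "holomorphic_rep unit_disc (\<lambda>z. p + d *\<^sub>R (Re z *\<^sub>R e1 + Im z *\<^sub>R e2)) ?F"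
    unfolding holomorphic_rep_def
    by (auto intro!: holomorphic_intros simp: vec_eq_iff c_def algebra_simps)
  show "\<forall>z\<in>unit_disc. (\<Sum>i\<in>UNIV. (deriv (?F i) z)\<^sup>2) = 0"
  proof
    fix z
    have D: "deriv (?F i) z = c i" for i
      by (rule DERIV_imp_deriv) (auto intro!: derivative_eq_intros)
    have "(\<Sum>i\<in>UNIV. (deriv (?F i) z)\<^sup>2) = (\<Sum>i\<in>UNIV. (c i)\<^sup>2)"
      using D by simp
    also have "\<dots> = (of_real d)\<^sup>2 * (\<Sum>i\<in>UNIV. (Complex (e1 $ i) (- (e2 $ i)))\<^sup>2)"
      by (simp add: c_def power_mult_distrib sum_distrib_left)
    also have "(\<Sum>i\<in>UNIV. (Complex (e1 $ i) (- (e2 $ i)))\<^sup>2) = Complex (e1 \<bullet> e1 - e2 \<bullet> e2) (- 2 * (e1 \<bullet> e2))"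
      by (simp add: complex_eq_iff inner_vec_def power2_eq_square sum_subtractf sum_distrib_left sum_negf algebra_simps)
    also have "\<dots> = 0" using e by (simp add: complex_eq_iff norm_eq_1)
    finally show "(\<Sum>i\<in>UNIV. (deriv (?F i) z)\<^sup>2) = 0" by simp
  qed
  show "(\<lambda>z. p + d *\<^sub>R (Re z *\<^sub>R e1 + Im z *\<^sub>R e2)) ` unit_disc \<subseteq> \<Omega>"
  proof (rule image_subsetI)
    fix z :: complex assume z: "z \<in> unit_disc"
    have "(norm (Re z *\<^sub>R e1 + Im z *\<^sub>R e2))\<^sup>2 = (norm z)\<^sup>2"
    proof -
      have "e1 \<bullet> e1 = 1" "e2 \<bullet> e2 = 1" "e2 \<bullet> e1 = 0"
        using e by (auto simp: norm_eq_1 inner_commute)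
      then show ?thesis
        unfolding cmod_power2 power2_norm_eq_inner using e(3)
        by (simp add: inner_add_left inner_add_right power2_eq_square)
    qed
    then have "norm (Re z *\<^sub>R e1 + Im z *\<^sub>R e2) = norm z" by (simp add: power2_eq_iff_nonneg)
    then have "p + d *\<^sub>R (Re z *\<^sub>R e1 + Im z *\<^sub>R e2) \<in> ball p d"
      using z d by (simp add: dist_norm)
    then show "p + d *\<^sub>R (Re z *\<^sub>R e1 + Im z *\<^sub>R e2) \<in> \<Omega>" using d by blast
  qed
qed

text \<open>A single flat disc centred at \<open>p\<close> and containing \<open>q\<close> suffices:
  \<open>q\<close> is the image of the real parameter |q - p| / d, which is at most 1/2. The
  dimension bound provides a second direction orthogonal to q - p. The constant depends only on
  \<open>d\<close>, which makes the estimate uniform along a path.\<close>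

lemma chain_distance_local:
  fixes p q :: "real^'n"
  assumes n: "CARD('n) \<ge> 2" and d: "d > 0" "ball p d \<subseteq> \<Omega>" and q: "norm (q - p) \<le> d / 2"
  shows "chain_distance \<Omega> p q \<le> ennreal (2 / d * norm (q - p))"
proof -
  obtain e1 :: "real^'n" where e1: "norm e1 = 1" "q - p = norm (q - p) *\<^sub>R e1"
  \<comment> \<open>For \<open>q = p\<close> there is no direction to normalize, and any unit vector
    serves.\<close>
  proof (cases "q = p")
    case True
    then show ?thesis using that[of "axis undefined 1"] by (simp add: norm_axis_1)
  next
    case False
    then show ?thesis using that[of "sgn (q - p)"] by (simp add: norm_sgn sgn_div_norm)
  qed
  obtain e where e: "e \<noteq> 0" "orthogonal e1 e"
    using orthogonal_to_vector_exists[of e1] n by auto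
  define e2 where "e2 = sgn e"
  have e2: "norm e2 = 1" "e1 \<bullet> e2 = 0"
    using e by (auto simp: e2_def norm_sgn sgn_div_norm orthogonal_def)
  define f where "f z = p + d *\<^sub>R (Re z *\<^sub>R e1 + Im z *\<^sub>R e2)" for z
  define s where "s = norm (q - p) / d"
  have s: "0 \<le> s" "s \<le> 1/2" using q d by (auto simp: s_def divide_simps)
  have "f \<in> CH \<Omega>" unfolding f_def using affine_disc_in_CH[OF d e1(1) e2] .
  moreover have "complex_of_real s \<in> unit_disc" using s by simp
  ultimately have "chain_distance \<Omega> (f 0) (f (of_real s)) \<le> ennreal (1/2 * ln ((1 + s) / (1 - s)))"
    using chain_distance_le_disc[of f \<Omega> "of_real s"] s by simp
  moreover have "f 0 = p" by (simp add: f_def)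
  moreover have "f (of_real s) = p + (q - p)" using e1(2) d by (simp add: f_def s_def)
  moreover have "ennreal (1/2 * ln ((1 + s) / (1 - s))) \<le> ennreal (2 * s)"
    using half_ln_ratio_le[OF s] by (rule ennreal_leI)
  ultimately show ?thesis by (simp add: s_def)
qed

subsection \<open>Integrating upper derivatives\<close>

text \<open>\<open>G\<close> need not be measurable: the upper derivative of \<open>u\<close> is, and the nonnegative integral is monotone
  for arbitrary functions.\<close>

lemma nn_integral_upper_Dini_ge:
  fixes u :: "real \<Rightarrow> real" and G :: "real \<Rightarrow> ennreal" and h :: "nat \<Rightarrow> real"
  assumes C: "C \<ge> 0" and h: "\<And>n. 0 < h n" "\<And>n. h n < \<delta>" "\<And>n. h n \<le> 1" "h \<longlonglongrightarrow> 0"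
    and lip: "\<And>s t. \<bar>s - t\<bar> < \<delta> \<Longrightarrow> \<bar>u s - u t\<bar> \<le> C * \<bar>s - t\<bar>"
    and u1: "\<And>t. t \<ge> 1 \<Longrightarrow> u t = u 1"
    and G: "AE t in lborel. t \<in> {0..1} \<longrightarrow> limsup (\<lambda>n. ennreal ((u (t + h n) - u t) / h n)) \<le> G t"
  shows "ennreal (u 1 - u 0) \<le> (\<integral>\<^sup>+t\<in>{0..1}. G t \<partial>lborel)"
proof -
  have \<delta>: "\<delta> > 0" using h(1,2)[of 0] by simp
  have "isCont u t" for t
  proof -
    have "eventually (\<lambda>s. \<bar>s - t\<bar> < \<delta>) (at t)"
      unfolding eventually_at using \<delta> by (auto simp: dist_real_def intro!: exI[of _ \<delta>])
    then have "eventually (\<lambda>s. norm (u s - u t) \<le> \<bar>s - t\<bar> * C) (at t)"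
      by eventually_elim (use lip in \<open>auto simp: mult.commute\<close>)
    moreover have "((\<lambda>s. \<bar>s - t\<bar> * C) \<longlongrightarrow> \<bar>t - t\<bar> * C) (at t)" by (intro tendsto_intros)
    ultimately have "((\<lambda>s. u s - u t) \<longlongrightarrow> 0) (at t)"
      using Lim_null_comparison[of "\<lambda>s. u s - u t" "\<lambda>s. \<bar>s - t\<bar> * C" "at t"] by simp
    then show ?thesis by (simp add: isCont_def LIM_zero_iff)
  qed
  then have cont: "continuous_on S u" for S by (simp add: continuous_at_imp_continuous_on)
  define q where "q n t = (u (t + h n) - u t) / h n" for n t
  have contq: "continuous_on S (q n)" for S n
    unfolding q_def using h(1)[of n]
    by (intro continuous_intros continuous_on_compose2[OF cont[of UNIV]]) auto
  have [measurable]: "q n \<in> borel_measurable borel" for n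
    by (intro borel_measurable_continuous_onI contq)
  have q_le: "q n t \<le> C" for n t
  proof -
    have "\<bar>u (t + h n) - u t\<bar> \<le> C * h n" using lip[of "t + h n" t] h(1,2)[of n] by simp
    then have "u (t + h n) - u t \<le> C * h n" by linarith
    then show ?thesis using h(1)[of n] by (simp add: q_def divide_simps)
  qed
  \<comment> \<open>\<open>ennreal\<close> sends negative values to 0, so \<open>Q n\<close> is the
    positive part of the difference quotient on the unit interval. The bound \<open>q_le\<close>
    supplies the integrable majorant for the reverse Fatou lemma.\<close>
  define Q where "Q n t = ennreal (q n t) * indicator {0..1} t" for n t
  have "limsup (\<lambda>n. integral\<^sup>N lborel (Q n)) \<le> (\<integral>\<^sup>+ t. limsup (\<lambda>n. Q n t) \<partial>lborel)"
  proof (rule nn_integral_limsup)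
    show "Q n \<in> borel_measurable lborel" for n unfolding Q_def by measurable
    show "(\<lambda>t::real. ennreal C * indicator {0..1} t) \<in> borel_measurable lborel" by measurable
    show "AE t in lborel. Q n t \<le> ennreal C * indicator {0..1} t" for n
      unfolding Q_def using q_le by (intro AE_I2 mult_right_mono ennreal_leI) auto
    show "(\<integral>\<^sup>+ t. ennreal C * indicator {0..1} (t::real) \<partial>lborel) < \<infinity>"
      by (simp add: nn_integral_cmult_indicator)
  qed
  also have "\<dots> \<le> (\<integral>\<^sup>+t\<in>{0..1}. G t \<partial>lborel)"
  proof (rule nn_integral_mono_AE, rule AE_mp[OF G], intro AE_I2 impI)
    fix t :: real assume "t \<in> {0..1} \<longrightarrow> limsup (\<lambda>n. ennreal ((u (t + h n) - u t) / h n)) \<le> G t"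
    then show "limsup (\<lambda>n. Q n t) \<le> G t * indicator {0..1} t"
      by (cases "t \<in> {0..1}") (auto simp: Q_def q_def Limsup_const)
  qed
  finally have upper: "limsup (\<lambda>n. integral\<^sup>N lborel (Q n)) \<le> (\<integral>\<^sup>+t\<in>{0..1}. G t \<partial>lborel)" .
  \<comment> \<open>The integral of the difference quotient is the mean of \<open>u\<close> over
    [1, 1 + h n] minus its mean over [0, h n]. The first is \<open>u 1\<close>, as \<open>u\<close>
    is constant after 1; the second is at most \<open>u 0 + C * h n\<close> by the Lipschitz bound.
    Passing to the positive part only increases the integral.\<close>
  have lower: "ennreal (u 1 - u 0 - C * h n) \<le> integral\<^sup>N lborel (Q n)" for n
  proof -
    have hn: "0 < h n" "h n \<le> 1" "h n < \<delta>" using h by auto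
    have int: "u integrable_on {a..b}" for a b by (intro integrable_continuous_interval cont)
    have "integral {0..1} (\<lambda>t. u (t + h n)) = integral {h n..1 + h n} u"
      using integral_shift[of 0 "h n" 1 u] cont by (simp add: o_def)
    also have "\<dots> = integral {h n..1} u + integral {1..1 + h n} u"
      by (rule Henstock_Kurzweil_Integration.integral_combine[symmetric]) (use hn int in auto)
    also have "integral {1..1 + h n} u = integral {1..1 + h n} (\<lambda>t. u 1)"
      by (intro Henstock_Kurzweil_Integration.integral_cong u1) simp
    also have "\<dots> = h n * u 1" using hn by simp
    finally have 1: "integral {0..1} (\<lambda>t. u (t + h n)) = integral {h n..1} u + h n * u 1" .
    have 2: "integral {0..1} u = integral {0..h n} u + integral {h n..1} u"
      by (rule Henstock_Kurzweil_Integration.integral_combine[symmetric]) (use hn int in auto)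
    have "integral {0..h n} u \<le> integral {0..h n} (\<lambda>t. u 0 + C * h n)"
    proof (rule integral_le[OF int])
      fix t assume t: "t \<in> {0..h n}"
      have "\<bar>u t - u 0\<bar> \<le> C * t" using lip[of t 0] t hn by simp
      also have "\<dots> \<le> C * h n" using t C by (intro mult_left_mono) auto
      finally show "u t \<le> u 0 + C * h n" by linarith
    qed auto
    also have "\<dots> = h n * (u 0 + C * h n)" using hn by simp
    finally have 3: "integral {0..h n} u \<le> h n * (u 0 + C * h n)" .
    have "integral {0..1} (q n) = (integral {0..1} (\<lambda>t. u (t + h n)) - integral {0..1} u) / h n"
      unfolding q_def
      by (subst integral_divide, subst Henstock_Kurzweil_Integration.integral_diff)
         (auto intro!: integrable_continuous_interval continuous_intros continuous_on_compose2[OF cont[of UNIV]])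
    then have "h n * integral {0..1} (q n) = h n * u 1 - integral {0..h n} u"
      using 1 2 hn by simp
    with 3 have "h n * (u 1 - u 0 - C * h n) \<le> h n * integral {0..1} (q n)"
      by (simp only: right_diff_distrib distrib_left)
    then have "u 1 - u 0 - C * h n \<le> integral {0..1} (q n)"
      using hn by (simp only: mult_le_cancel_left_pos)
    also have "\<dots> \<le> integral {0..1} (\<lambda>t. max 0 (q n t))"
      by (intro integral_le integrable_continuous_interval continuous_on_max contq continuous_on_const) auto
    finally have "ennreal (u 1 - u 0 - C * h n) \<le> ennreal (integral {0..1} (\<lambda>t. max 0 (q n t)))"
      by (rule ennreal_leI)
    also have "\<dots> = (\<integral>\<^sup>+t. ennreal (max 0 (q n t)) * indicator {0..1} t \<partial>lborel)"
      by (intro nn_integral_has_integral_lebesgue'[symmetric] integrable_integral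
          integrable_continuous_interval continuous_on_max contq continuous_on_const) auto
    also have "\<dots> = integral\<^sup>N lborel (Q n)"
      unfolding Q_def by (simp add: ennreal_max_0)
    finally show ?thesis .
  qed
  have "(\<lambda>n. ennreal (u 1 - u 0 - C * h n)) \<longlonglongrightarrow> ennreal (u 1 - u 0 - C * 0)"
    by (intro tendsto_intros h)
  then have "ennreal (u 1 - u 0) = limsup (\<lambda>n. ennreal (u 1 - u 0 - C * h n))"
    by (intro lim_imp_Limsup[symmetric]) auto
  also have "\<dots> \<le> limsup (\<lambda>n. integral\<^sup>N lborel (Q n))"
    using lower by (intro Limsup_mono always_eventually) auto
  finally show ?thesis using upper by simp
qed

text \<open>For each competitor \<open>f\<close> with f_x(0) = r v, both f(s/r) and \<gamma>(t + s)
  equal \<gamma>(t) + s v + o(s). Going along \<open>f\<close> to f(s/r) and then along a flat disc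
  to \<gamma>(t + s) costs s/r + o(s), so the quotient has limsup at most 1/r; the infimum over
  \<open>f\<close> follows.\<close>

lemma limsup_chain_distance_le_minimal_metric:
  fixes \<gamma> :: "real \<Rightarrow> real^'n"
  assumes n: "CARD('n) \<ge> 2" and \<Omega>: "open \<Omega>" "\<gamma> t \<in> \<Omega>"
    and \<gamma>: "(\<gamma> has_vector_derivative v) (at t)"
    and h: "\<And>n. 0 < h n" "h \<longlonglongrightarrow> 0"
  shows "limsup (\<lambda>n. ennreal (1 / h n) * chain_distance \<Omega> (\<gamma> t) (\<gamma> (t + h n))) \<le> minimal_metric \<Omega> (\<gamma> t) v"
  unfolding minimal_metric_def
proof (rule Inf_greatest, clarify)
  fix r f assume r: "1 / r > 0" and f: "f \<in> CH \<Omega>" "f 0 = \<gamma> t" "partial_x f 0 = r *\<^sub>R v"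
  have r: "r > 0" using r by simp
  obtain d0 where d0: "d0 > 0" "ball (\<gamma> t) d0 \<subseteq> \<Omega>" using \<Omega> open_contains_ball by blast
  \<comment> \<open>Halving leaves room for the flat disc: once f(a(h n)) is within \<open>d\<close>
    of \<open>\<gamma> t\<close>, the ball of radius \<open>d\<close> around it still lies in
    \<Omega>.\<close>
  define d where "d = d0 / 2"
  have d: "d > 0" "ball (\<gamma> t) (2 * d) \<subseteq> \<Omega>" using d0 by (auto simp: d_def)
  have hat: "filterlim h (at 0) sequentially"
    using h by (intro filterlim_atI always_eventually) (auto simp: less_imp_neq[symmetric])
  define a where "a s = complex_of_real (s / r)" for s
  define e where "e s = \<gamma> (t + s) - f (a s)" for s
  have Df: "(f has_derivative frechet_derivative f (at 0)) (at 0)"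
    using f by (intro CH_differentiable) auto
  define D where "D = frechet_derivative f (at 0)"
  have D1: "D 1 = r *\<^sub>R v" using f by (simp add: D_def partial_x_def)
  have Da: "D (a s) = s *\<^sub>R v" for s
  proof -
    have "a s = (s / r) *\<^sub>R 1" by (simp add: a_def scaleR_conv_of_real)
    then have "D (a s) = (s / r) *\<^sub>R D 1"
      using linear_scale[OF has_derivative_linear[OF Df]] by (simp add: D_def)
    then show ?thesis using r D1 by simp
  qed
  have "(a has_derivative a) (at 0)"
    unfolding a_def using r by (auto intro!: derivative_eq_intros)
  moreover have "(f has_derivative D) (at (a 0))" using Df by (simp add: a_def D_def)
  ultimately have fa: "((\<lambda>s. f (a s)) has_derivative (\<lambda>s. s *\<^sub>R v)) (at 0)"
    using diff_chain_at[of a a 0 f D] Da by (simp add: o_def)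
  have "((\<lambda>s. t + s) has_derivative (\<lambda>s. s)) (at 0)" by (auto intro!: derivative_eq_intros)
  moreover have "(\<gamma> has_derivative (\<lambda>s. s *\<^sub>R v)) (at (t + 0))"
    using \<gamma> by (simp add: has_vector_derivative_def)
  ultimately have "((\<lambda>s. \<gamma> (t + s)) has_derivative (\<lambda>s. s *\<^sub>R v)) (at 0)"
    using diff_chain_at[of "\<lambda>s. t + s" "\<lambda>s. s" 0 \<gamma> "\<lambda>s. s *\<^sub>R v"] by (simp add: o_def)
  from has_derivative_diff[OF this fa] have De: "(e has_derivative (\<lambda>s. 0)) (at 0)"
    by (simp add: e_def[abs_def])
  have e0: "e 0 = 0" using f by (simp add: e_def a_def)
  from De have "((\<lambda>s. norm (e s) / \<bar>s\<bar>) \<longlongrightarrow> 0) (at 0)"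
    unfolding has_derivative_at using e0 by simp
  then have "(\<lambda>n. norm (e (h n)) / \<bar>h n\<bar>) \<longlonglongrightarrow> 0"
    by (rule filterlim_compose[OF _ hat])
  then have e_lim: "(\<lambda>n. norm (e (h n)) / h n) \<longlonglongrightarrow> 0"
    using h(1) by (simp add: less_imp_le)
  have "(e \<longlongrightarrow> 0) (at 0)"
    using has_derivative_continuous[OF De] e0 by (simp add: isCont_def)
  then have "(\<lambda>n. e (h n)) \<longlonglongrightarrow> 0" by (rule filterlim_compose[OF _ hat])
  then have ev1: "\<forall>\<^sub>F n in sequentially. norm (e (h n)) < d / 2"
    using d by (intro order_tendstoD(2)[OF tendsto_norm_zero]) auto
  have "((\<lambda>s. f (a s)) \<longlongrightarrow> \<gamma> t) (at 0)"
    using has_derivative_continuous[OF fa] f by (simp add: isCont_def a_def)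
  then have "(\<lambda>n. f (a (h n))) \<longlonglongrightarrow> \<gamma> t" by (rule filterlim_compose[OF _ hat])
  then have ev2: "\<forall>\<^sub>F n in sequentially. dist (f (a (h n))) (\<gamma> t) < d"
    using d(1) by (rule tendstoD)
  have ev3: "\<forall>\<^sub>F n in sequentially. h n < r"
    using h(2) r by (rule order_tendstoD)
  \<comment> \<open>The hyperbolic length of the radius to \<open>a s\<close>, for small s > 0. Its
    derivative 1/r at 0 gives the main term of the quotient, while the error term contributes
    nothing in the limit.\<close>
  define L where "L s = 1/2 * ln ((1 + s / r) / (1 - s / r))" for s
  have "(L has_real_derivative 1 / r) (at 0)"
    unfolding L_def using r by (auto intro!: derivative_eq_intros)
  then have "((\<lambda>s. L s / s) \<longlongrightarrow> 1 / r) (at 0)"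
    by (simp add: DERIV_def L_def)
  then have L_lim: "(\<lambda>n. L (h n) / h n) \<longlonglongrightarrow> 1 / r"
    by (rule filterlim_compose[OF _ hat])
  define B where "B n = L (h n) / h n + 2 / d * (norm (e (h n)) / h n)" for n
  have "B \<longlonglongrightarrow> 1 / r + 2 / d * 0" unfolding B_def by (intro tendsto_intros L_lim e_lim)
  then have B_lim: "(\<lambda>n. ennreal (B n)) \<longlonglongrightarrow> ennreal (1 / r)" by (intro tendsto_ennrealI) simp
  have "\<forall>\<^sub>F n in sequentially. ennreal (1 / h n) * chain_distance \<Omega> (\<gamma> t) (\<gamma> (t + h n)) \<le> ennreal (B n)"
    using ev1 ev2 ev3
  proof eventually_elim
    case (elim n)
    have hn: "0 < h n" by (rule h)
    have a_norm: "norm (a (h n)) = h n / r" using hn r by (simp add: a_def norm_divide)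
    have a_disc: "a (h n) \<in> unit_disc" using elim hn r by (simp add: a_norm)
    have L_nonneg: "0 \<le> L (h n)"
      unfolding L_def using elim hn r by (intro mult_nonneg_nonneg ln_ge_zero) (auto simp: divide_simps)
    have "ball (f (a (h n))) d \<subseteq> \<Omega>"
    proof -
      have "ball (f (a (h n))) d \<subseteq> ball (\<gamma> t) (2 * d)"
        using elim by (subst ball_subset_ball_iff) (auto simp: dist_commute)
      then show ?thesis using d by blast
    qed
    then have 2: "chain_distance \<Omega> (f (a (h n))) (\<gamma> (t + h n)) \<le> ennreal (2 / d * norm (e (h n)))"
      unfolding e_def using elim(1) by (intro chain_distance_local n d(1)) (auto simp: e_def)
    have 1: "chain_distance \<Omega> (\<gamma> t) (f (a (h n))) \<le> ennreal (L (h n))"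
      using chain_distance_le_disc[OF f(1) a_disc] f(2) by (simp add: a_norm L_def)
    have "chain_distance \<Omega> (\<gamma> t) (\<gamma> (t + h n)) \<le> ennreal (L (h n)) + ennreal (2 / d * norm (e (h n)))"
      by (rule order_trans[OF chain_distance_triangle add_mono[OF 1 2]])
    also have "\<dots> = ennreal (L (h n) + 2 / d * norm (e (h n)))"
      using L_nonneg d by (simp add: ennreal_plus)
    finally have "ennreal (1 / h n) * chain_distance \<Omega> (\<gamma> t) (\<gamma> (t + h n))
        \<le> ennreal (1 / h n) * ennreal (L (h n) + 2 / d * norm (e (h n)))"
      by (intro mult_left_mono) auto
    also have "\<dots> = ennreal (1 / h n * (L (h n) + 2 / d * norm (e (h n))))"
      using hn L_nonneg d by (intro ennreal_mult[symmetric]) auto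
    also have "1 / h n * (L (h n) + 2 / d * norm (e (h n))) = B n"
      by (simp add: B_def distrib_left)
    finally show ?case .
  qed
  then have "limsup (\<lambda>n. ennreal (1 / h n) * chain_distance \<Omega> (\<gamma> t) (\<gamma> (t + h n))) \<le> limsup (\<lambda>n. ennreal (B n))"
    by (rule Limsup_mono)
  also have "\<dots> = ennreal (1 / r)" using B_lim by (intro lim_imp_Limsup) auto
  finally show "limsup (\<lambda>n. ennreal (1 / h n) * chain_distance \<Omega> (\<gamma> t) (\<gamma> (t + h n))) \<le> ennreal (1 / r)" .
qed

section \<open>Regularity of piecewise smooth paths and the bound of chain distance by path
  length\<close>

lemma smooth_on_interval_lipschitz:
  assumes "smooth_on_interval a b f"
  shows "\<exists>M. M-lipschitz_on {a..b} f"
proof -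
  obtain D where D: "\<And>t. t \<in> {a..b} \<Longrightarrow> D (0::nat) t = f t"
    "\<And>k t. t \<in> {a..b} \<Longrightarrow> (D k has_vector_derivative D (Suc k) t) (at t within {a..b})"
    using assms unfolding smooth_on_interval_def by blast
  \<comment> \<open>Smoothness includes the endpoints, so the first derivative is continuous on a
    compact interval and hence bounded.\<close>
  have "continuous_on {a..b} (D 1)"
    using D(2)[of _ 1] has_vector_derivative_continuous continuous_on_eq_continuous_within by blast
  then have "bounded (D 1 ` {a..b})" by (intro compact_imp_bounded compact_continuous_image) auto
  then obtain M where M: "M > 0" "\<And>t. t \<in> {a..b} \<Longrightarrow> norm (D 1 t) \<le> M"
    unfolding bounded_pos by auto
  have "M-lipschitz_on {a..b} (D 0)"
  proof (rule bounded_derivative_imp_lipschitz)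
    fix t assume t: "t \<in> {a..b}"
    show "(D 0 has_derivative (\<lambda>s. s *\<^sub>R D 1 t)) (at t within {a..b})"
      using D(2)[OF t, of 0] by (simp add: has_vector_derivative_def)
    show "onorm (\<lambda>s. s *\<^sub>R D 1 t) \<le> M"
    proof (rule onorm_le)
      fix s :: real
      show "norm (s *\<^sub>R D 1 t) \<le> M * norm s"
        using mult_right_mono[OF M(2)[OF t], of "\<bar>s\<bar>"] by (simp add: mult.commute)
    qed
  qed (use M in auto)
  then have "M-lipschitz_on {a..b} f"
    using D(1) by (simp add: lipschitz_on_def)
  then show ?thesis ..
qed

lemma piecewise_smooth_path_lipschitz:
  assumes "piecewise_smooth_path \<gamma>"
  shows "\<exists>M. M-lipschitz_on {0..1} \<gamma>"
proof -
  obtain N s where s: "s 0 = 0" "s N = 1" "\<And>i. i < N \<Longrightarrow> s i < s (Suc i)"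
    "\<And>i. i < N \<Longrightarrow> smooth_on_interval (s i) (s (Suc i)) \<gamma>"
    using assms unfolding piecewise_smooth_path_def by blast
  have "n \<le> N \<Longrightarrow> \<exists>M. M-lipschitz_on {s 0..s n} \<gamma>" for n
  proof (induction n)
    case 0
    then show ?case by (auto simp: lipschitz_on_def intro!: exI[of _ 0])
  next
    case (Suc n)
    then obtain M where M: "M-lipschitz_on {s 0..s n} \<gamma>" by auto
    obtain M' where M': "M'-lipschitz_on {s n..s (Suc n)} \<gamma>"
      using smooth_on_interval_lipschitz[OF s(4), of n] Suc.prems by auto
    from lipschitz_on_concat_max[OF M M' refl] show ?case by auto
  qed
  then show ?thesis using s by (metis order_refl)
qed

lemma piecewise_smooth_path_differentiable:
  assumes "piecewise_smooth_path \<gamma>"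
  shows "\<exists>S. finite S \<and> (\<forall>t\<in>{0..1} - S. t \<in> {0<..<1} \<and> \<gamma> differentiable (at t))"
proof -
  obtain N s where s: "s 0 = 0" "s N = 1" "\<And>i. i < N \<Longrightarrow> s i < s (Suc i)"
    "\<And>i. i < N \<Longrightarrow> smooth_on_interval (s i) (s (Suc i)) \<gamma>"
    using assms unfolding piecewise_smooth_path_def by blast
  \<comment> \<open>The exceptional set consists of all partition points, including 0 and 1; at any
    other point the one-sided derivatives of a smooth piece become a two-sided one.\<close>
  have "t \<in> {0<..<1} \<and> \<gamma> differentiable (at t)" if t: "t \<in> {0..1} - s ` {..N}" for t
  proof -
    obtain i where i: "i < N" "t \<in> {s i<..<s (Suc i)}"
      using t s partition_cases[of t s N] by auto
    obtain D where D: "\<And>t. t \<in> {s i..s (Suc i)} \<Longrightarrow> D (0::nat) t = \<gamma> t"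
      "\<And>k t. t \<in> {s i..s (Suc i)} \<Longrightarrow> (D k has_vector_derivative D (Suc k) t) (at t within {s i..s (Suc i)})"
      using s(4)[OF i(1)] unfolding smooth_on_interval_def by blast
    have "(D 0 has_vector_derivative D 1 t) (at t within {s i..s (Suc i)})"
      using D(2)[of t 0] i by simp
    then have "(D 0 has_vector_derivative D 1 t) (at t)"
      using i by (simp add: at_within_Icc_at)
    then have "(\<gamma> has_vector_derivative D 1 t) (at t)"
      by (rule has_vector_derivative_transform_within_open[OF _ _ i(2)]) (use D(1) in auto)
    moreover have "0 \<noteq> t" "1 \<noteq> t" using t s(1,2) by (metis Diff_iff atMost_iff image_eqI le0 order_refl)+
    ultimately show ?thesis
      using t by (auto simp: has_vector_derivative_def differentiable_def)
  qed
  then show ?thesis by (intro exI[of _ "s ` {..N}"]) auto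
qed

text \<open>The function u(t) = \<tau>(x, \<gamma>(t)) has total increase \<tau>(x, y). It is
  locally Lipschitz by the flat-disc estimate, and by the triangle inequality its upper derivative
  is at most the minimal metric of the velocity outside a finite set; the integration lemma does the
  rest.\<close>

lemma chain_distance_le_path_length:
  fixes x y :: "real^'n"
  assumes n: "CARD('n) \<ge> 2" and \<Omega>: "open \<Omega>" and \<gamma>: "\<gamma> \<in> piecewise_smooth_paths_in \<Omega> x y"
  shows "chain_distance \<Omega> x y \<le> (\<integral>\<^sup>+t\<in>{0..1}. minimal_metric \<Omega> (\<gamma> t) (vector_derivative \<gamma> (at t)) \<partial>lborel)"
proof -
  have ps: "piecewise_smooth_path \<gamma>" and im: "path_image \<gamma> \<subseteq> \<Omega>" and ends: "\<gamma> 0 = x" "\<gamma> 1 = y"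
    using \<gamma> by (auto simp: piecewise_smooth_paths_in_def pathstart_def pathfinish_def)
  have "compact (path_image \<gamma>)" using ps by (simp add: piecewise_smooth_path_def compact_path_image)
  \<comment> \<open>Compactness of the path gives one radius for all its points, hence one Lipschitz
    constant.\<close>
  then obtain d where d: "d > 0" "(\<Union>p\<in>path_image \<gamma>. ball p d) \<subseteq> \<Omega>"
    using compact_subset_open_imp_ball_epsilon_subset[OF _ \<Omega> im] by blast
  obtain M0 where "M0-lipschitz_on {0..1} \<gamma>" using piecewise_smooth_path_lipschitz[OF ps] ..
  then have M: "(max M0 1)-lipschitz_on {0..1} \<gamma>" by (rule lipschitz_on_mono) auto
  define M where "M = max M0 1"
  \<comment> \<open>Clamping the parameter extends the path by constants to the whole line, as the
    integration lemma evaluates \<open>u\<close> beyond 1. It is 1-Lipschitz, so the constant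
    \<open>M\<close> survives.\<close>
  define cl :: "real \<Rightarrow> real" where "cl t = max 0 (min 1 t)" for t
  have cl: "cl t \<in> {0..1}" "\<bar>cl s - cl t\<bar> \<le> \<bar>s - t\<bar>" for s t by (auto simp: cl_def)
  define \<eta> where "\<eta> t = \<gamma> (cl t)" for t
  have M_lip: "norm (\<eta> t - \<eta> s) \<le> M * \<bar>s - t\<bar>" for s t
  proof -
    have "norm (\<eta> t - \<eta> s) \<le> M * \<bar>cl t - cl s\<bar>"
      using lipschitz_onD[OF M cl(1) cl(1), of t s] by (simp add: \<eta>_def M_def dist_norm)
    also have "\<dots> \<le> M * \<bar>s - t\<bar>" using cl(2)[of t s] by (intro mult_left_mono) (auto simp: M_def abs_minus_commute)
    finally show ?thesis .
  qed
  define C where "C = 2 / d * M"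
  \<comment> \<open>Parameters closer than d / (2 M) give points at distance at most d/2, the range
    of the flat-disc estimate; the bound 1 keeps the steps \<open>h n\<close> at most 1. Taking
    \<open>M\<close> at least 1 avoids division by zero.\<close>
  define \<delta> where "\<delta> = min 1 (d / (2 * M))"
  have M1: "M \<ge> 1" by (simp add: M_def)
  have C: "C \<ge> 0" using d M1 by (simp add: C_def)
  have \<delta>: "\<delta> > 0" "\<delta> \<le> 1" using d M1 by (auto simp: \<delta>_def)
  have local: "chain_distance \<Omega> (\<eta> s) (\<eta> t) \<le> ennreal (C * \<bar>s - t\<bar>)" if "\<bar>s - t\<bar> < \<delta>" for s t
  proof -
    have "\<eta> s \<in> path_image \<gamma>" using cl by (auto simp: \<eta>_def path_image_def)
    then have b: "ball (\<eta> s) d \<subseteq> \<Omega>" using d by blast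
    have "M * \<bar>s - t\<bar> \<le> M * (d / (2 * M))" using that M1 by (intro mult_left_mono) (auto simp: \<delta>_def)
    also have "\<dots> = d / 2" using M1 by simp
    finally have "norm (\<eta> t - \<eta> s) \<le> d / 2" using M_lip[of t s] by linarith
    then have "chain_distance \<Omega> (\<eta> s) (\<eta> t) \<le> ennreal (2 / d * norm (\<eta> t - \<eta> s))"
      by (intro chain_distance_local n d b)
    also have "\<dots> \<le> ennreal (2 / d * (M * \<bar>s - t\<bar>))"
      using M_lip[of t s] d by (intro ennreal_leI mult_left_mono) auto
    finally show ?thesis by (simp add: C_def mult.assoc)
  qed
  have \<eta>1: "\<eta> t = y" if "t \<ge> 1" for t using ends that by (auto simp: \<eta>_def cl_def)
  have \<eta>0: "\<eta> 0 = x" using ends by (simp add: \<eta>_def cl_def)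
  \<comment> \<open>Finiteness is needed before passing to real values, where
    \<open>enn2real\<close> would turn infinity into 0. It follows by joining 0 to \<open>t\<close>
    in steps of length at most \<delta>/2.\<close>
  have fin: "chain_distance \<Omega> x (\<eta> t) < top" for t
  proof -
    have "\<bar>t\<bar> \<le> real k * (\<delta> / 2) \<Longrightarrow> chain_distance \<Omega> x (\<eta> t) < top" for k t
    proof (induction k arbitrary: t)
      case 0
      then show ?case using local[of 0 0] \<delta> \<eta>0 by (simp add: top.not_eq_extremum le_zero_eq)
    next
      case (Suc k)
      \<comment> \<open>Shrinking \<open>t\<close> towards 0 by the factor k/(k+1) handles both
        signs at once: |s| \<le> k \<delta>/2, and the remaining step is at most \<delta>/2.\<close>
      define s where "s = t * (real k / (real k + 1))"
      have ts: "t - s = t / (real k + 1)" by (simp add: s_def field_simps)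
      have t: "\<bar>t\<bar> \<le> (real k + 1) * (\<delta> / 2)" using Suc.prems by (simp add: algebra_simps)
      have "\<bar>s\<bar> = \<bar>t\<bar> * (real k / (real k + 1))" by (simp add: s_def abs_mult)
      also have "\<dots> \<le> ((real k + 1) * (\<delta> / 2)) * (real k / (real k + 1))"
        using t by (intro mult_right_mono) auto
      also have "\<dots> = real k * (\<delta> / 2)" by (simp add: field_simps)
      finally have s: "chain_distance \<Omega> x (\<eta> s) < top" by (rule Suc.IH)
      have "\<bar>s - t\<bar> = \<bar>t\<bar> / (real k + 1)"
        by (simp add: abs_minus_commute[of s t] ts)
      also have "\<dots> \<le> \<delta> / 2" using t by (simp add: divide_simps mult.commute)
      also have "\<dots> < \<delta>" using \<delta> by simp
      finally have "chain_distance \<Omega> (\<eta> s) (\<eta> t) \<le> ennreal (C * \<bar>s - t\<bar>)" by (rule local)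
      then have "chain_distance \<Omega> (\<eta> s) (\<eta> t) < top" using ennreal_less_top le_less_trans by blast
      then show ?case using s le_less_trans[OF chain_distance_triangle[of \<Omega> x "\<eta> t" "\<eta> s"]] by simp
    qed
    moreover obtain k where "\<bar>t\<bar> / (\<delta> / 2) \<le> real k" using real_arch_simple by blast
    then have "\<bar>t\<bar> \<le> real k * (\<delta> / 2)" using \<delta> by (simp add: divide_simps)
    ultimately show ?thesis by blast
  qed
  define u where "u t = enn2real (chain_distance \<Omega> x (\<eta> t))" for t
  have u: "ennreal (u t) = chain_distance \<Omega> x (\<eta> t)" "0 \<le> u t" for t
    using fin[of t] by (auto simp: u_def)
  have u_tri: "ennreal (u t) \<le> ennreal (u s) + chain_distance \<Omega> (\<eta> s) (\<eta> t)" for s t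
    unfolding u by (rule chain_distance_triangle)
  have u_step: "u t \<le> u s + C * \<bar>s - t\<bar>" if "\<bar>s - t\<bar> < \<delta>" for s t
  proof -
    have "ennreal (u t) \<le> ennreal (u s) + ennreal (C * \<bar>s - t\<bar>)"
      by (rule order_trans[OF u_tri add_left_mono[OF local[OF that]]])
    also have "\<dots> = ennreal (u s + C * \<bar>s - t\<bar>)"
      using u C by (intro ennreal_plus[symmetric]) auto
    finally show ?thesis using u C by (subst (asm) ennreal_le_iff) auto
  qed
  \<comment> \<open>The shift by 2 makes \<open>h n < \<delta>\<close> strict already at
    \<open>n = 0\<close>.\<close>
  define h where "h n = \<delta> / (real n + 2)" for n
  have h: "0 < h n" "h n < \<delta>" "h n \<le> 1" for n
  proof -
    show "0 < h n" using \<delta> by (simp add: h_def)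
    have "\<delta> / (real n + 2) < \<delta> / 1" using \<delta> by (intro divide_strict_left_mono) auto
    then show "h n < \<delta>" by (simp add: h_def)
    then show "h n \<le> 1" using \<delta> by simp
  qed
  have h_lim: "h \<longlonglongrightarrow> 0"
    unfolding h_def using LIMSEQ_ignore_initial_segment[OF lim_const_over_n, of \<delta> 2] by (simp add: add.commute)
  obtain S where S: "finite S" "\<And>t. t \<in> {0..1} - S \<Longrightarrow> t \<in> {0<..<1} \<and> \<gamma> differentiable (at t)"
    using piecewise_smooth_path_differentiable[OF ps] by blast
  have "AE t in lborel. t \<notin> S" using S by (intro AE_not_in finite_imp_null_set_lborel)
  then have G: "AE t in lborel. t \<in> {0..1} \<longrightarrow> limsup (\<lambda>n. ennreal ((u (t + h n) - u t) / h n))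
      \<le> minimal_metric \<Omega> (\<gamma> t) (vector_derivative \<gamma> (at t))"
  proof (rule AE_mp, intro AE_I2 impI)
    fix t assume "t \<notin> S" "t \<in> {0..1}"
    then have t: "t \<in> {0<..<1}" "\<gamma> differentiable (at t)" using S by auto
    \<comment> \<open>On the open interval the clamped path coincides with \<gamma>, so it has the
      same derivative at \<open>t\<close>.\<close>
    have ev: "\<eta> s = \<gamma> s" if "s \<in> {0<..<1}" for s using that by (simp add: \<eta>_def cl_def)
    have "(\<gamma> has_vector_derivative vector_derivative \<gamma> (at t)) (at t)"
      using t by (simp add: vector_derivative_works)
    then have \<eta>': "(\<eta> has_vector_derivative vector_derivative \<gamma> (at t)) (at t)"
      by (rule has_vector_derivative_transform_within_open[OF _ _ t(1)]) (use ev in auto)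
    have "\<gamma> t \<in> \<Omega>" using im t by (auto simp: path_image_def)
    then have "\<eta> t \<in> \<Omega>" using ev[OF t(1)] by simp
    from limsup_chain_distance_le_minimal_metric[OF n \<Omega> this \<eta>' h(1) h_lim]
    have "limsup (\<lambda>n. ennreal (1 / h n) * chain_distance \<Omega> (\<eta> t) (\<eta> (t + h n)))
        \<le> minimal_metric \<Omega> (\<gamma> t) (vector_derivative \<gamma> (at t))"
      by (simp add: ev[OF t(1)])
    moreover
    have "ennreal ((u (t + h n) - u t) / h n) \<le> ennreal (1 / h n) * chain_distance \<Omega> (\<eta> t) (\<eta> (t + h n))" for n
    proof -
      have "ennreal (u (t + h n) - u t) \<le> chain_distance \<Omega> (\<eta> t) (\<eta> (t + h n))"
      proof -
        \<comment> \<open>Subtraction in \<open>ennreal\<close> is truncated at 0, as is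
          \<open>ennreal\<close> of a negative real; the triangle inequality therefore applies
          whether \<open>u\<close> increases or decreases.\<close>
        have "ennreal (u (t + h n) - u t) = ennreal (u (t + h n)) - ennreal (u t)"
          by (rule ennreal_minus[OF u(2), symmetric])
        also have "\<dots> \<le> chain_distance \<Omega> (\<eta> t) (\<eta> (t + h n))"
          using u_tri[of "t + h n" t] by (simp add: ennreal_minus_le_iff)
        finally show ?thesis .
      qed
      then have "ennreal (1 / h n) * ennreal (u (t + h n) - u t) \<le> ennreal (1 / h n) * chain_distance \<Omega> (\<eta> t) (\<eta> (t + h n))"
        by (intro mult_left_mono) auto
      moreover have "ennreal ((u (t + h n) - u t) / h n) = ennreal (1 / h n) * ennreal (u (t + h n) - u t)"
        using h(1)[of n] by (simp add: ennreal_mult'[symmetric])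
      ultimately show ?thesis by simp
    qed
    then have "limsup (\<lambda>n. ennreal ((u (t + h n) - u t) / h n))
        \<le> limsup (\<lambda>n. ennreal (1 / h n) * chain_distance \<Omega> (\<eta> t) (\<eta> (t + h n)))"
      by (intro Limsup_mono always_eventually allI)
    ultimately show "limsup (\<lambda>n. ennreal ((u (t + h n) - u t) / h n))
        \<le> minimal_metric \<Omega> (\<gamma> t) (vector_derivative \<gamma> (at t))"
      by (rule order_trans[rotated])
  qed
  have "ennreal (u 1 - u 0) \<le> (\<integral>\<^sup>+t\<in>{0..1}. minimal_metric \<Omega> (\<gamma> t) (vector_derivative \<gamma> (at t)) \<partial>lborel)"
  proof (rule nn_integral_upper_Dini_ge[OF C h h_lim _ _ G])
    show "\<bar>u s - u t\<bar> \<le> C * \<bar>s - t\<bar>" if "\<bar>s - t\<bar> < \<delta>" for s t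
      using u_step[OF that] u_step[of t s] that by (simp add: abs_minus_commute abs_le_iff)
    show "u t = u 1" if "t \<ge> 1" for t using \<eta>1[OF that] \<eta>1[of 1] by (simp add: u_def)
  qed
  moreover have "u 0 = 0"
    using local[of 0 0] \<delta> \<eta>0 by (simp add: u_def)
  ultimately show ?thesis using u(1)[of 1] \<eta>1[of 1] by simp
qed

theorem theorem3p1:
  fixes \<Omega> :: "(real ^ 'n) set"
  assumes "CARD('n) \<ge> 3"
    and "open \<Omega>" and "connected \<Omega>" and "\<Omega> \<noteq> {}"
  shows "\<forall>x\<in>\<Omega>. \<forall>y\<in>\<Omega>. minimal_distance \<Omega> x y = chain_distance \<Omega> x y"
proof (intro ballI antisym)
  fix x y
  show "minimal_distance \<Omega> x y \<le> chain_distance \<Omega> x y"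
    by (rule minimal_distance_le_chain_distance)
  show "chain_distance \<Omega> x y \<le> minimal_distance \<Omega> x y"
    unfolding minimal_distance_def using assms(1,2)
    by (intro INF_greatest chain_distance_le_path_length) auto
qed

end
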